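(* Let $\tau\in T_{\mathbb C}$. Assume that $I_\tau$ is irreducible (as a ${}^{BL}\mathcal H_{\mathbb C}$-module). Then: (1) $W_\tau=W_{(\tau)}$; (2) for all $\alpha^\vee\in\Phi^\vee$, $\tau(\alpha^\vee)\neq q$.
   Context: Let $\mathcal S=(A,X,Y,(\alpha_i)_{i\in I},(\alpha_i^\vee)_{i\in I})$ be a root generating system: $A=(a_{i,j})$ is a Kac–Moody matrix (finite index set $I$, integer entries, $a_{i,i}=2$, $a_{i,j}\le 0$ for $i\ne j$, $a_{i,j}=0\iff a_{j,i}=0$), $X,Y$ are dual free $\mathbb Z$-modules of finite rank, $(\alpha_i)$ and $(\alpha_i^\vee)$ are free families in $X$ and $Y$ with $\alpha_j(\alpha_i^\vee)=a_{i,j}$. Put $\mathbb A=Y\otimes\mathbb R$, $r_i(v)=v-\alpha_i(v)\alpha_i^\vee$, $\mathscr S=\{r_i\}$, $W^v=\langle\mathscr S\rangle\subset GL(\mathbb A)$ (Coxeter group with length $\ell$); for $s=r_i$ write $\alpha_s=\alpha_i$, $\alpha_s^\vee=\alpha_i^\vee$. $\Phi^\vee=\{w.\alpha_s^\vee\mid w\in W^v,s\in\mathscr S\}$ is the set of real coroots; for $\alpha^\vee=w.\alpha_s^\vee$, $r_{\alpha^\vee}=wsw^{-1}$. Let $q$ be the residue cardinality of a non-Archimedean local field $\mathcal K$ ($G$ is the split Kac–Moody group over $\mathcal K$ attached to $\mathcal S$). The Bernstein–Lusztig–Hecke algebra ${}^{BL}\mathcal H_{\mathbb C}$ of $G$ is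 the $\mathbb C$-vector space with basis $(Z^\lambda H_w)_{\lambda\in Y,w\in W^v}$ ($Z^\lambda=Z^\lambda H_1$, $H_w=Z^0H_w$) with the unique associative product such that $Z^\lambda*H_w=Z^\lambda H_w$; $Z^\lambda*Z^\mu=Z^{\lambda+\mu}$; $H_s*H_w=H_{sw}$ if $\ell(sw)=\ell(w)+1$ and $H_s*H_w=(\sqrt q-\sqrt q^{-1})H_w+H_{sw}$ if $\ell(sw)=\ell(w)-1$; and $H_s*Z^\lambda-Z^{s.\lambda}*H_s=\frac{\sqrt q-\sqrt q^{-1}}{1-Z^{-\alpha_s^\vee}}(Z^\lambda-Z^{s.\lambda})$. $T_{\mathbb C}=\mathrm{Hom}_{\mathrm{Gr}}(Y,\mathbb C^* )$, with $(w.\tau)(\lambda)=\tau(w^{-1}.\lambda)$; $\tau$ is extended to an algebra morphism $\mathbb C[Y]=\bigoplus_\lambda\mathbb CZ^\lambda\to\mathbb C$; $I_\tau={}^{BL}\mathcal H_{\mathbb C}\otimes_{\mathbb C[Y]}\mathbb C$, $\mathbb C[Y]$ acting on $\mathbb C$ via $\tau$. $W_\tau=\{w\in W^v\mid w.\tau=\tau\}$, and $W_{(\tau)}$ is the subgroup of $W_\tau$ generated by the reflections $r_{\alpha^\vee}$ for $\alpha^\vee\in\Phi^\vee$ such that $\tau(\alpha^\vee)=1$. *)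

theory Defs
  imports Complex_Main "HOL-Algebra.Free_Abelian_Groups"
begin

text \<open>
  The real vector space A = Y \<otimes> R is the type \<^typ>\<open>'v\<close>, and the free Z-module Y is identified with
  its image in A, that is, with the Z-span of an R-basis of A. Accordingly X = Hom(Y, Z) is the set
  of linear forms on A that are integral on Y.
\<close>

record ('i, 'v) root_system =
  idx :: "'i set"
  cartan :: "'i \<Rightarrow> 'i \<Rightarrow> int"
  X_lattice :: "('v \<Rightarrow> real) set"
  Y_lattice :: "'v set"
  simple_root :: "'i \<Rightarrow> 'v \<Rightarrow> real"
  simple_coroot :: "'i \<Rightarrow> 'v"

definition Kac_Moody_matrix :: "'i set \<Rightarrow> ('i \<Rightarrow> 'i \<Rightarrow> int) \<Rightarrow> bool" where
  "Kac_Moody_matrix I A \<longleftrightarrow> finite I \<and> (\<forall>i\<in>I. A i i = 2) \<and>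
     (\<forall>i\<in>I. \<forall>j\<in>I. i \<noteq> j \<longrightarrow> A i j \<le> 0) \<and>
     (\<forall>i\<in>I. \<forall>j\<in>I. A i j = 0 \<longleftrightarrow> A j i = 0)"

definition full_lattice :: "'v::real_vector set \<Rightarrow> bool" where
  "full_lattice Y \<longleftrightarrow> (\<exists>B. finite B \<and> independent B \<and> span B = UNIV \<and>
     Y = range (\<lambda>n::'v \<Rightarrow> int. \<Sum>b\<in>B. of_int (n b) *\<^sub>R b))"

definition dual_lattice :: "'v::real_vector set \<Rightarrow> ('v \<Rightarrow> real) set" where
  "dual_lattice Y = {f. linear f \<and> f ` Y \<subseteq> \<int>}"

definition root_generating_system :: "('i, 'v::real_vector) root_system \<Rightarrow> bool" where
  "root_generating_system S \<longleftrightarrow>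
     Kac_Moody_matrix (idx S) (cartan S) \<and>
     full_lattice (Y_lattice S) \<and> X_lattice S = dual_lattice (Y_lattice S) \<and>
     simple_root S ` idx S \<subseteq> X_lattice S \<and> simple_coroot S ` idx S \<subseteq> Y_lattice S \<and>
     (\<forall>c::'i \<Rightarrow> int. (\<forall>v. (\<Sum>i\<in>idx S. of_int (c i) * simple_root S i v) = 0)
        \<longrightarrow> (\<forall>i\<in>idx S. c i = 0)) \<and>
     (\<forall>c::'i \<Rightarrow> int. (\<Sum>i\<in>idx S. of_int (c i) *\<^sub>R simple_coroot S i) = 0
        \<longrightarrow> (\<forall>i\<in>idx S. c i = 0)) \<and>
     (\<forall>i\<in>idx S. \<forall>j\<in>idx S. simple_root S j (simple_coroot S i) = of_int (cartan S i j))"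

definition GL :: "('v::real_vector \<Rightarrow> 'v) monoid" where
  "GL = \<lparr>carrier = {f. linear f \<and> bij f}, mult = (\<circ>), one = id\<rparr>"

definition simple_refl :: "('i, 'v::real_vector) root_system \<Rightarrow> 'i \<Rightarrow> 'v \<Rightarrow> 'v" where
  "simple_refl S i v = v - simple_root S i v *\<^sub>R simple_coroot S i"

definition weyl_group :: "('i, 'v::real_vector) root_system \<Rightarrow> ('v \<Rightarrow> 'v) set" where
  "weyl_group S = generate GL (simple_refl S ` idx S)"

definition weyl_length :: "('i, 'v::real_vector) root_system \<Rightarrow> ('v \<Rightarrow> 'v) \<Rightarrow> nat" where
  "weyl_length S w = (LEAST n. \<exists>is. length is = n \<and> set is \<subseteq> idx S \<and>
     w = foldr (\<circ>) (map (simple_refl S) is) id)"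

definition real_coroots :: "('i, 'v::real_vector) root_system \<Rightarrow> 'v set" where
  "real_coroots S = {w (simple_coroot S i) | w i. w \<in> weyl_group S \<and> i \<in> idx S}"

text \<open>\<open>coroot_reflection S \<beta> r\<close> says that r is the reflection attached to the real coroot \<beta>;
  as a relation it does not presuppose that \<open>w s w\<^sup>-\<^sup>1\<close> depends only on \<beta>.\<close>

definition coroot_reflection ::
    "('i, 'v::real_vector) root_system \<Rightarrow> 'v \<Rightarrow> ('v \<Rightarrow> 'v) \<Rightarrow> bool" where
  "coroot_reflection S \<beta> r \<longleftrightarrow> (\<exists>w\<in>weyl_group S. \<exists>i\<in>idx S.
     \<beta> = w (simple_coroot S i) \<and> r = w \<circ> simple_refl S i \<circ> inv_into UNIV w)"

text \<open>The values of a character off Y are irrelevant.\<close>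

definition torus_character :: "('i, 'v::real_vector) root_system \<Rightarrow> ('v \<Rightarrow> complex) \<Rightarrow> bool" where
  "torus_character S \<tau> \<longleftrightarrow> (\<forall>\<nu>\<in>Y_lattice S. \<tau> \<nu> \<noteq> 0) \<and>
     (\<forall>\<nu>\<in>Y_lattice S. \<forall>\<mu>\<in>Y_lattice S. \<tau> (\<nu> + \<mu>) = \<tau> \<nu> * \<tau> \<mu>)"

definition weyl_act_char :: "('v \<Rightarrow> 'v) \<Rightarrow> ('v \<Rightarrow> complex) \<Rightarrow> 'v \<Rightarrow> complex" where
  "weyl_act_char w \<tau> \<nu> = \<tau> (inv_into UNIV w \<nu>)"

definition W_stab :: "('i, 'v::real_vector) root_system \<Rightarrow> ('v \<Rightarrow> complex) \<Rightarrow> ('v \<Rightarrow> 'v) set" where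
  "W_stab S \<tau> = {w \<in> weyl_group S. \<forall>\<nu>\<in>Y_lattice S. weyl_act_char w \<tau> \<nu> = \<tau> \<nu>}"

definition W_refl :: "('i, 'v::real_vector) root_system \<Rightarrow> ('v \<Rightarrow> complex) \<Rightarrow> ('v \<Rightarrow> 'v) set" where
  "W_refl S \<tau> = generate GL {r. \<exists>\<beta>\<in>real_coroots S. \<tau> \<beta> = 1 \<and> coroot_reflection S \<beta> r}"

text \<open>A field that is complete for a normalised discrete valuation, with finite residue field. The
  value of the valuation at 0 is irrelevant.\<close>

definition val_ideal :: "('k::field \<Rightarrow> int) \<Rightarrow> int \<Rightarrow> 'k set" where
  "val_ideal v n = {x. x = 0 \<or> n \<le> v x}"

definition residue_field :: "('k::field \<Rightarrow> int) \<Rightarrow> 'k set set" where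
  "residue_field v = val_ideal v 0 //
     {(x, y). x \<in> val_ideal v 0 \<and> y \<in> val_ideal v 0 \<and> x - y \<in> val_ideal v 1}"

definition nonarch_local_field :: "('k::field \<Rightarrow> int) \<Rightarrow> bool" where
  "nonarch_local_field v \<longleftrightarrow>
     (\<forall>x y. x \<noteq> 0 \<longrightarrow> y \<noteq> 0 \<longrightarrow> v (x * y) = v x + v y) \<and>
     (\<forall>x y. x \<noteq> 0 \<longrightarrow> y \<noteq> 0 \<longrightarrow> x + y \<noteq> 0 \<longrightarrow> min (v x) (v y) \<le> v (x + y)) \<and>
     v ` (UNIV - {0}) = UNIV \<and>
     (\<forall>x::nat \<Rightarrow> 'k. (\<forall>n. \<exists>N. \<forall>j\<ge>N. \<forall>k\<ge>N. x j - x k \<in> val_ideal v n) \<longrightarrow>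
        (\<exists>l. \<forall>n. \<exists>N. \<forall>j\<ge>N. x j - l \<in> val_ideal v n)) \<and>
     finite (residue_field v)"

text \<open>The vector space with basis \<open>Z\<^sup>\<nu> H\<^sub>w\<close> consists of the finitely supported functions on
  pairs \<open>(\<nu>, w)\<close> whose support lies in \<open>Y \<times> W\<close>; the basis is \<open>ZH \<nu> w\<close>.\<close>

type_synonym 'v hecke = "('v \<times> ('v \<Rightarrow> 'v)) \<Rightarrow>\<^sub>0 complex"

definition hecke_space :: "('i, 'v::real_vector) root_system \<Rightarrow> 'v hecke set" where
  "hecke_space S = {f. Poly_Mapping.keys f \<subseteq> Y_lattice S \<times> weyl_group S}"

definition group_algebra :: "('i, 'v::real_vector) root_system \<Rightarrow> 'v hecke set" where
  "group_algebra S = {f. Poly_Mapping.keys f \<subseteq> Y_lattice S \<times> {id}}"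

definition hscale :: "complex \<Rightarrow> 'v hecke \<Rightarrow> 'v hecke" where
  "hscale c f = Poly_Mapping.map (\<lambda>x. c * x) f"

definition ZH :: "'v \<Rightarrow> ('v \<Rightarrow> 'v) \<Rightarrow> 'v hecke" where
  "ZH \<nu> w = Poly_Mapping.single (\<nu>, w) 1"

abbreviation Zb :: "'v \<Rightarrow> 'v hecke" where
  "Zb \<nu> \<equiv> ZH \<nu> id"

abbreviation Hb :: "('v::zero \<Rightarrow> 'v) \<Rightarrow> 'v hecke" where
  "Hb w \<equiv> ZH 0 w"

definition bilinear_assoc_on :: "'v hecke set \<Rightarrow> ('v hecke \<Rightarrow> 'v hecke \<Rightarrow> 'v hecke) \<Rightarrow> bool" where
  "bilinear_assoc_on V m \<longleftrightarrow>
     (\<forall>a\<in>V. \<forall>b\<in>V. m a b \<in> V) \<and>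
     (\<forall>a\<in>V. \<forall>b\<in>V. \<forall>c\<in>V. m (a + b) c = m a c + m b c \<and> m a (b + c) = m a b + m a c) \<and>
     (\<forall>x. \<forall>a\<in>V. \<forall>b\<in>V. m (hscale x a) b = hscale x (m a b) \<and> m a (hscale x b) = hscale x (m a b)) \<and>
     (\<forall>a\<in>V. \<forall>b\<in>V. \<forall>c\<in>V. m (m a b) c = m a (m b c))"

text \<open>The last clause is the Bernstein--Lusztig relation: the element D of the integral domain C[Y]
  with \<open>(1 - Z\<^bsup>-\<alpha>\<^esup>) D = Z\<^sup>\<nu> - Z\<^bsup>s\<nu>\<^esup>\<close>, where \<alpha> is the coroot of s, is the quotient in its
  right-hand side.\<close>

definition BLH_product ::
    "('i, 'v::real_vector) root_system \<Rightarrow> nat \<Rightarrow> ('v hecke \<Rightarrow> 'v hecke \<Rightarrow> 'v hecke) \<Rightarrow> bool" where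
  "BLH_product S q m \<longleftrightarrow>
     (let Y = Y_lattice S; W = weyl_group S; l = weyl_length S;
          c = complex_of_real (sqrt (real q) - inverse (sqrt (real q))) in
      bilinear_assoc_on (hecke_space S) m \<and>
      (\<forall>\<nu>\<in>Y. \<forall>w\<in>W. m (Zb \<nu>) (Hb w) = ZH \<nu> w) \<and>
      (\<forall>\<nu>\<in>Y. \<forall>\<mu>\<in>Y. m (Zb \<nu>) (Zb \<mu>) = Zb (\<nu> + \<mu>)) \<and>
      (\<forall>i\<in>idx S. \<forall>w\<in>W. let s = simple_refl S i in
         (l (s \<circ> w) = l w + 1 \<longrightarrow> m (Hb s) (Hb w) = Hb (s \<circ> w)) \<and>
         (l w = l (s \<circ> w) + 1 \<longrightarrow> m (Hb s) (Hb w) = hscale c (Hb w) + Hb (s \<circ> w))) \<and>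
      (\<forall>i\<in>idx S. \<forall>\<nu>\<in>Y. let s = simple_refl S i in
         \<exists>D\<in>group_algebra S. m (Zb 0 - Zb (- simple_coroot S i)) D = Zb \<nu> - Zb (s \<nu>) \<and>
           m (Hb s) (Zb \<nu>) - m (Zb (s \<nu>)) (Hb s) = hscale c D))"

text \<open>The tensor product over R of a right R-module M (with action ra) and a left R-module N (with
  action la), as a quotient of the free abelian group on \<open>M \<times> N\<close>.\<close>

definition tensor_relations ::
    "'m::ab_group_add set \<Rightarrow> 'r set \<Rightarrow> 'n::ab_group_add set \<Rightarrow> ('m \<Rightarrow> 'r \<Rightarrow> 'm) \<Rightarrow> ('r \<Rightarrow> 'n \<Rightarrow> 'n)
      \<Rightarrow> (('m \<times> 'n) \<Rightarrow>\<^sub>0 int) set" where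
  "tensor_relations M R N ra la =
     {frag_of (x + x', y) - frag_of (x, y) - frag_of (x', y) | x x' y. x \<in> M \<and> x' \<in> M \<and> y \<in> N} \<union>
     {frag_of (x, y + y') - frag_of (x, y) - frag_of (x, y') | x y y'. x \<in> M \<and> y \<in> N \<and> y' \<in> N} \<union>
     {frag_of (ra x a, y) - frag_of (x, la a y) | x a y. x \<in> M \<and> a \<in> R \<and> y \<in> N}"

definition tensor_null ::
    "'m::ab_group_add set \<Rightarrow> 'r set \<Rightarrow> 'n::ab_group_add set \<Rightarrow> ('m \<Rightarrow> 'r \<Rightarrow> 'm) \<Rightarrow> ('r \<Rightarrow> 'n \<Rightarrow> 'n)
      \<Rightarrow> (('m \<times> 'n) \<Rightarrow>\<^sub>0 int) set" where
  "tensor_null M R N ra la =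
     generate (free_Abelian_group (M \<times> N)) (tensor_relations M R N ra la)"

definition tensor_product ::
    "'m::ab_group_add set \<Rightarrow> 'r set \<Rightarrow> 'n::ab_group_add set \<Rightarrow> ('m \<Rightarrow> 'r \<Rightarrow> 'm) \<Rightarrow> ('r \<Rightarrow> 'n \<Rightarrow> 'n)
      \<Rightarrow> (('m \<times> 'n) \<Rightarrow>\<^sub>0 int) set monoid" where
  "tensor_product M R N ra la = free_Abelian_group (M \<times> N) Mod tensor_null M R N ra la"

text \<open>The map \<open>f \<otimes> id\<close> on classes: the image of a coset under the induced map of free abelian
  groups is contained in a single coset, which is recovered by adding the subgroup of relations.\<close>

definition tensor_map_left ::
    "'m::ab_group_add set \<Rightarrow> 'r set \<Rightarrow> 'n::ab_group_add set \<Rightarrow> ('m \<Rightarrow> 'r \<Rightarrow> 'm) \<Rightarrow> ('r \<Rightarrow> 'n \<Rightarrow> 'n)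
      \<Rightarrow> ('m \<Rightarrow> 'm) \<Rightarrow> (('m \<times> 'n) \<Rightarrow>\<^sub>0 int) set \<Rightarrow> (('m \<times> 'n) \<Rightarrow>\<^sub>0 int) set" where
  "tensor_map_left M R N ra la f C =
     tensor_null M R N ra la <#>\<^bsub>free_Abelian_group (M \<times> N)\<^esub>
       (frag_extend (\<lambda>(x, y). frag_of (f x, y)) ` C)"

definition char_ext :: "('v \<Rightarrow> complex) \<Rightarrow> 'v hecke \<Rightarrow> complex" where
  "char_ext \<tau> f = (\<Sum>k\<in>Poly_Mapping.keys f. Poly_Mapping.lookup f k * \<tau> (fst k))"

definition I_module ::
    "('i, 'v::real_vector) root_system \<Rightarrow> ('v hecke \<Rightarrow> 'v hecke \<Rightarrow> 'v hecke) \<Rightarrow> ('v \<Rightarrow> complex)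
      \<Rightarrow> (('v hecke \<times> complex) \<Rightarrow>\<^sub>0 int) set monoid" where
  "I_module S m \<tau> =
     tensor_product (hecke_space S) (group_algebra S) UNIV m (\<lambda>\<theta> z. char_ext \<tau> \<theta> * z)"

definition I_action ::
    "('i, 'v::real_vector) root_system \<Rightarrow> ('v hecke \<Rightarrow> 'v hecke \<Rightarrow> 'v hecke) \<Rightarrow> ('v \<Rightarrow> complex)
      \<Rightarrow> 'v hecke \<Rightarrow> (('v hecke \<times> complex) \<Rightarrow>\<^sub>0 int) set \<Rightarrow> (('v hecke \<times> complex) \<Rightarrow>\<^sub>0 int) set" where
  "I_action S m \<tau> h =
     tensor_map_left (hecke_space S) (group_algebra S) UNIV m (\<lambda>\<theta> z. char_ext \<tau> \<theta> * z) (m h)"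

definition irreducible_module :: "'r set \<Rightarrow> 'a monoid \<Rightarrow> ('r \<Rightarrow> 'a \<Rightarrow> 'a) \<Rightarrow> bool" where
  "irreducible_module R M act \<longleftrightarrow> carrier M \<noteq> {\<one>\<^bsub>M\<^esub>} \<and>
     (\<forall>N. subgroup N M \<longrightarrow> (\<forall>a\<in>R. \<forall>x\<in>N. act a x \<in> N) \<longrightarrow> N = {\<one>\<^bsub>M\<^esub>} \<or> N = carrier M)"

end

theory Submission
  imports Defs "Jordan_Normal_Form.Determinant" "HOL-Analysis.Continuum_Not_Denumerable"
    "HOL-Computational_Algebra.Fundamental_Theorem_Algebra"
begin

text \<open>
  The elements \<open>H\<^sub>w Z\<^sup>\<nu>\<close> form a basis of the algebra, by triangularity with respect to length, so
  \<open>I\<^sub>\<tau>\<close> is free of rank one over the subspace HW spanned by the \<open>H\<^sub>w\<close>, with generator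
  \<open>1 \<otimes> 1\<close> of weight \<open>\<tau>\<close>. If x is a vector of weight \<open>\<chi>\<close> and \<open>\<chi>(\<alpha>\<^sub>s) \<noteq> 1\<close>, where \<open>\<alpha>\<^sub>s\<close> is the
  coroot of s, then \<open>(H\<^sub>s - Q) x\<close> has weight \<open>s.\<chi>\<close> for a suitable scalar Q, and \<open>H\<^sub>s - Q\<close> is
  invertible unless \<open>\<chi>(\<alpha>\<^sub>s)\<close> is q or 1/q. If \<open>I\<^sub>\<tau>\<close> is irreducible, every nonzero weight vector, seen
  in HW, is left invertible.

  If u fixes \<open>\<tau>\<close> but is not a product of reflections in coroots on which \<open>\<tau>\<close> is 1, choose u of
  minimal length. The condition \<open>\<chi>(\<alpha>\<^sub>s) \<noteq> 1\<close> then holds along a reduced word of u, because otherwise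
  deleting a letter would give a shorter such element. This produces a vector of weight \<open>\<tau>\<close> which is
  not a multiple of the generator, contradicting Schur's lemma, which is available because HW has
  countable dimension over an uncountable field.

  If \<open>\<tau>\<close> takes the value q at some real coroot \<open>w.\<alpha>\<^sub>s\<close>, choose a word for w as short as possible
  among all such coroots for q and 1/q. Along this word all intertwiners are defined and invertible,
  and applying \<open>H\<^sub>s - Q\<close> at its end gives a weight vector that is a zero divisor times a unit, hence
  not left invertible.
\<close>

section \<open>Determinants of reflections\<close>

text \<open>With U the column of the \<open>u i\<close> and V the row of the \<open>v j\<close>, the
  matrix is 1 - UV. The block matrix with rows (1, V) and (U, 1) is a product of block triangular
  matrices in two ways, one giving the determinant of 1 - UV and the other the scalar 1 -
  VU.\<close>

lemma det_one_minus_rank_one: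
  fixes u v :: "nat \<Rightarrow> 'a :: idom"
  shows "det (mat n n (\<lambda>(i, j). (if i = j then 1 else 0) - v j * u i)) = 1 - (\<Sum>i<n. v i * u i)"
proof -
  define U where "U = mat n 1 (\<lambda>(i, j). u i)"
  define V where "V = mat 1 n (\<lambda>(i, j). v j)"
  define M where "M = mat n n (\<lambda>(i, j). (if i = j then 1 else 0) - v j * u i)"
  define d where "d = 1 - (\<Sum>i<n. v i * u i)"
  define D where "D = mat 1 1 (\<lambda>(i::nat, j::nat). d)"
  have car: "U \<in> carrier_mat n 1" "V \<in> carrier_mat 1 n" "M \<in> carrier_mat n n" "D \<in> carrier_mat 1 1"
    by (auto simp: U_def V_def M_def D_def)
  have UV: "U * V + M = 1\<^sub>m n"
    by (rule eq_matI) (auto simp: U_def V_def M_def scalar_prod_def)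
  have VU: "D + V * U = 1\<^sub>m 1"
    by (rule eq_matI) (auto simp: U_def V_def D_def d_def scalar_prod_def lessThan_atLeast0)
  have 1: "four_block_mat (1\<^sub>m 1) (0\<^sub>m 1 n) U (1\<^sub>m n) * four_block_mat (1\<^sub>m 1) V (0\<^sub>m n 1) M
      = four_block_mat (1\<^sub>m 1) V U (1\<^sub>m n)"
    by (subst mult_four_block_mat) (use car UV in auto)
  have 2: "four_block_mat D V (0\<^sub>m n 1) (1\<^sub>m n) * four_block_mat (1\<^sub>m 1) (0\<^sub>m 1 n) U (1\<^sub>m n)
      = four_block_mat (1\<^sub>m 1) V U (1\<^sub>m n)"
    by (subst mult_four_block_mat) (use car VU in auto)
  let ?L = "four_block_mat (1\<^sub>m 1) (0\<^sub>m 1 n) U (1\<^sub>m n)"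
  have L: "det ?L = 1"
    by (subst det_four_block_mat_upper_right_zero[of _ 1 _ n]) (use car in auto)
  have fb: "?L \<in> carrier_mat (1 + n) (1 + n)"
    "four_block_mat (1\<^sub>m 1) V (0\<^sub>m n 1) M \<in> carrier_mat (1 + n) (1 + n)"
    "four_block_mat D V (0\<^sub>m n 1) (1\<^sub>m n) \<in> carrier_mat (1 + n) (1 + n)"
    using car by (blast intro: four_block_carrier_mat one_carrier_mat)+
  have "det (four_block_mat (1\<^sub>m 1) V (0\<^sub>m n 1) M) = det M"
    using det_four_block_mat_lower_left_zero[OF one_carrier_mat car(2) refl car(3)] by simp
  then have "det (?L * four_block_mat (1\<^sub>m 1) V (0\<^sub>m n 1) M) = det M"
    using det_mult[OF fb(1,2)] L by simp
  moreover have "det (four_block_mat D V (0\<^sub>m n 1) (1\<^sub>m n)) = det D"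
    using det_four_block_mat_lower_left_zero[OF car(4,2) refl one_carrier_mat] by simp
  then have "det (four_block_mat D V (0\<^sub>m n 1) (1\<^sub>m n) * ?L) = det D"
    using det_mult[OF fb(3,1)] L by simp
  moreover have "det D = d"
    by (simp add: D_def det_single)
  ultimately show ?thesis
    using 1 2 by (simp add: M_def d_def)
qed

text \<open>A determinant on the abstract space, taken in coordinates for B. Its value -1 on
  reflections makes it the sign character of the Weyl group.\<close>

lemma ex_determinant_of_reflections:
  fixes B :: "'v::real_vector set"
  assumes B: "finite B" "independent B" "span B = UNIV"
  obtains d :: "('v \<Rightarrow> 'v) \<Rightarrow> real" where "d id = 1"
    "\<And>f g. linear f \<Longrightarrow> linear g \<Longrightarrow> d (f \<circ> g) = d f * d g"
    "\<And>\<alpha> u. linear \<alpha> \<Longrightarrow> \<alpha> u = 2 \<Longrightarrow> d (\<lambda>v. v - \<alpha> v *\<^sub>R u) = -1"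
proof -
  obtain bs where bs: "set bs = B" "distinct bs"
    using finite_distinct_list[OF B(1)] by blast
  define n where "n = length bs"
  define rep where "rep v i = representation B v (bs ! i)" for v i
  define M where "M f = mat n n (\<lambda>(i, j). rep (f (bs ! j)) i)" for f
  have bij: "bij_betw (nth bs) {..<n} B"
    unfolding n_def using bij_betw_nth[OF bs(2)] bs(1) by blast
  have expand: "(\<Sum>k<n. rep v k *\<^sub>R (bs ! k)) = v" for v
  proof -
    have "(\<Sum>k<n. rep v k *\<^sub>R (bs ! k)) = (\<Sum>b\<in>B. representation B v b *\<^sub>R b)"
      unfolding rep_def by (rule sum.reindex_bij_betw[OF bij])
    also have "\<dots> = v"
      by (rule real_vector.sum_representation_eq) (use B in auto)
    finally show ?thesis .
  qed
  have rep_lin: "rep (f v) i = (\<Sum>k<n. rep v k * rep (f (bs ! k)) i)" if "linear f" for f v i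
  proof -
    have "rep (f v) i = rep (f (\<Sum>k<n. rep v k *\<^sub>R (bs ! k))) i"
      by (simp add: expand)
    also have "f (\<Sum>k<n. rep v k *\<^sub>R (bs ! k)) = (\<Sum>k<n. rep v k *\<^sub>R f (bs ! k))"
      using that by (simp add: linear_sum linear_scale)
    also have "rep \<dots> i = (\<Sum>k<n. rep v k * rep (f (bs ! k)) i)"
      unfolding rep_def using B
      by (simp add: real_vector.representation_sum real_vector.representation_scale)
    finally show ?thesis .
  qed
  have rep_basis: "rep (bs ! j) i = (if i = j then 1 else 0)" if "i < n" "j < n" for i j
    unfolding rep_def using that B bs
    by (auto simp: real_vector.representation_basis n_def nth_eq_iff_index_eq)
  show thesis
  proof
    have "M id = 1\<^sub>m n"
      by (rule eq_matI) (auto simp: M_def rep_basis)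
    then show "det (M id) = 1" by simp
  next
    fix f g :: "'v \<Rightarrow> 'v" assume "linear f" "linear g"
    have "M (f \<circ> g) = M f * M g"
      by (rule eq_matI)
        (auto simp: M_def scalar_prod_def rep_lin[OF \<open>linear f\<close>, of "g _"] mult.commute lessThan_atLeast0)
    then show "det (M (f \<circ> g)) = det (M f) * det (M g)"
      using det_mult[of "M f" n "M g"] by (simp add: M_def)
  next
    fix \<alpha> :: "'v \<Rightarrow> real" and u assume a: "linear \<alpha>" "\<alpha> u = 2"
    have "M (\<lambda>v. v - \<alpha> v *\<^sub>R u) = mat n n (\<lambda>(i, j). (if i = j then 1 else 0) - \<alpha> (bs ! j) * rep u i)"
    proof (rule eq_matI)
      fix i j
      assume "i < dim_row (mat n n (\<lambda>(i, j). (if i = j then 1 else 0) - \<alpha> (bs ! j) * rep u i))"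
        "j < dim_col (mat n n (\<lambda>(i, j). (if i = j then 1 else 0) - \<alpha> (bs ! j) * rep u i))"
      then have "i < n" "j < n" by auto
      have "rep (bs ! j - \<alpha> (bs ! j) *\<^sub>R u) i = rep (bs ! j) i - \<alpha> (bs ! j) * rep u i"
        unfolding rep_def using B
        by (simp add: real_vector.representation_diff real_vector.representation_scale)
      then show "M (\<lambda>v. v - \<alpha> v *\<^sub>R u) $$ (i, j) =
          mat n n (\<lambda>(i, j). (if i = j then 1 else 0) - \<alpha> (bs ! j) * rep u i) $$ (i, j)"
        using \<open>i < n\<close> \<open>j < n\<close> by (simp add: M_def rep_basis)
    qed (auto simp: M_def)
    then have "det (M (\<lambda>v. v - \<alpha> v *\<^sub>R u)) = 1 - (\<Sum>i<n. \<alpha> (bs ! i) * rep u i)"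
      by (simp add: det_one_minus_rank_one)
    also have "(\<Sum>i<n. \<alpha> (bs ! i) * rep u i) = \<alpha> (\<Sum>k<n. rep u k *\<^sub>R (bs ! k))"
      using a(1) by (simp add: linear_sum linear_scale mult.commute)
    finally show "det (M (\<lambda>v. v - \<alpha> v *\<^sub>R u)) = - 1"
      using a(2) by (simp add: expand)
  qed
qed

section \<open>Schur's lemma in countable dimension\<close>

text \<open>This is p(\<phi>) applied to x, evaluated by Horner's scheme.\<close>

definition poly_op :: "(complex \<Rightarrow> 'b \<Rightarrow> 'b) \<Rightarrow> ('b \<Rightarrow> 'b) \<Rightarrow> complex poly \<Rightarrow> 'b \<Rightarrow> 'b::ab_group_add" where
  "poly_op scale \<phi> p x = fold_coeffs (\<lambda>a y. scale a x + \<phi> y) p 0"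

locale vector_space_endo = vector_space scale
  for scale :: "complex \<Rightarrow> 'b::ab_group_add \<Rightarrow> 'b" (infixr "*s" 75) +
  fixes \<phi> :: "'b \<Rightarrow> 'b"
  assumes linear_\<phi>: "Vector_Spaces.linear scale scale \<phi>"
begin

sublocale \<phi>: Vector_Spaces.linear scale scale \<phi> by (fact linear_\<phi>)

abbreviation ev :: "complex poly \<Rightarrow> 'b \<Rightarrow> 'b" where "ev \<equiv> poly_op scale \<phi>"

lemma ev_0 [simp]: "ev 0 x = 0"
  by (simp add: poly_op_def)

lemma ev_pCons [simp]: "ev (pCons a p) x = a *s x + \<phi> (ev p x)"
  by (cases "a = 0 \<and> p = 0") (auto simp: poly_op_def \<phi>.zero)

lemma ev_add: "ev (p + q) x = ev p x + ev q x"
  by (induction p q rule: poly_induct2) (auto simp: \<phi>.add scale_left_distrib algebra_simps)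

lemma ev_smult: "ev (smult a p) x = a *s ev p x"
  by (induction p) (auto simp: \<phi>.scale scale_right_distrib)

lemma ev_sum: "ev (\<Sum>i\<in>A. f i) x = (\<Sum>i\<in>A. ev (f i) x)"
  by (induction A rule: infinite_finite_induct) (auto simp: ev_add)

lemma ev_zero_right: "ev p 0 = 0"
  by (induction p) (auto simp: \<phi>.zero)

lemma ev_diff_right: "ev p (x - y) = ev p x - ev p y"
  by (induction p) (auto simp: \<phi>.diff scale_right_diff_distrib)

lemma ev_scale_right: "ev p (c *s x) = c *s ev p x"
  by (induction p) (auto simp: \<phi>.scale algebra_simps)

lemma ev_sum_right: "ev p (\<Sum>i\<in>A. f i) = (\<Sum>i\<in>A. ev p (f i))"
proof (induction A rule: infinite_finite_induct)
  case (insert a A)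
  have "ev p (f a + sum f A) = ev p (f a) + ev p (sum f A)"
    using ev_diff_right[of p "f a + sum f A" "sum f A"] by (simp add: algebra_simps)
  with insert show ?case by simp
qed (auto simp: ev_zero_right)

lemma ev_\<phi>: "ev p (\<phi> x) = \<phi> (ev p x)"
  by (induction p) (auto simp: \<phi>.zero \<phi>.add \<phi>.scale)

text \<open>Splits off a root; this serves both an induction on the degree and a partial fraction
  argument.\<close>

lemma ev_linear_factor: "ev ([:- c, 1:] * p) x = ev p (\<phi> x - c *s x)"
proof -
  have "[:- c, 1:] * p = pCons 0 p + smult (- c) p" by simp
  then show ?thesis
    by (simp only: ev_add ev_smult ev_diff_right ev_scale_right ev_\<phi> ev_pCons) simp
qed

text \<open>Schur's lemma for an endomorphism of a space of countable dimension over an uncountable field: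
  if no \<open>\<phi> - c\<close> has a kernel, then the vectors \<open>(\<phi> - c)\<^sup>-\<^sup>1 v\<close> are linearly independent.\<close>

lemma resolvent_not_everywhere:
  assumes U: "subspace U" "countable B" "U \<subseteq> span B" and \<phi>U: "\<phi> ` U \<subseteq> U"
    and v: "v \<in> U" "v \<noteq> 0"
    and inj: "\<And>c x. x \<in> U \<Longrightarrow> \<phi> x = c *s x \<Longrightarrow> x = 0"
    and res: "\<And>c. \<exists>u\<in>U. \<phi> u - c *s u = v"
  shows False
proof -
  obtain u where u: "\<And>c. u c \<in> U" "\<And>c. \<phi> (u c) - c *s u c = v"
    using res by metis
  have evU: "ev p x \<in> U" if "x \<in> U" for p x
    using that \<phi>U by (induction p) (auto intro: subspace_0 subspace_add subspace_scale U)
  \<comment> \<open>Over the complex numbers the polynomial splits, and each linear factor acts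
    injectively.\<close>
  have ev_inj: "x = 0" if "x \<in> U" "p \<noteq> 0" "ev p x = 0" for p x
    using that
  proof (induction "degree p" arbitrary: p x)
    case 0
    then obtain a where "p = [:a:]" by (metis degree_eq_zeroE)
    with 0 show ?case by (simp add: \<phi>.zero)
  next
    case (Suc n)
    then have "\<not> constant (poly p)"
      by (simp add: constant_degree)
    then obtain c where "poly p c = 0"
      using fundamental_theorem_of_algebra by blast
    then obtain p' where p': "p = [:- c, 1:] * p'"
      unfolding poly_eq_0_iff_dvd by blast
    with Suc.prems have "p' \<noteq> 0" by auto
    then have "degree p' = n"
      using Suc.hyps(2) p' by (simp add: degree_mult_eq del: mult_pCons_left)
    moreover have "\<phi> x - c *s x \<in> U"
      using Suc.prems(1) \<phi>U by (auto intro: subspace_diff subspace_scale U)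
    ultimately have "\<phi> x - c *s x = 0"
      using Suc.hyps(1) \<open>p' \<noteq> 0\<close> Suc.prems(3) unfolding p' ev_linear_factor by blast
    then show ?case using inj[of x c] Suc.prems(1) by simp
  qed
  have "inj u"
  proof (rule injI)
    fix c d assume eq: "u c = u d"
    have "c *s u c = d *s u c"
      using u(2)[of c] u(2)[of d] eq by (metis diff_left_imp_eq)
    moreover have "u c \<noteq> 0"
      using u(2)[of c] v(2) by (auto simp: \<phi>.zero)
    ultimately show "c = d" by simp
  qed
  have "independent (range u)"
    unfolding independent_explicit_finite_subsets
  proof (intro allI impI ballI)
    fix T f b
    assume T: "T \<subseteq> range u" "finite T" and sum0: "(\<Sum>x\<in>T. f x *s x) = 0" and "b \<in> T"
    define F where "F = u -` T"
    define a where "a c = f (u c)" for c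
    have fin: "finite F"
      unfolding F_def using \<open>inj u\<close> T(2) by (simp add: finite_vimageI)
    have TF: "T = u ` F" using T(1) by (auto simp: F_def)
    obtain d where d: "b = u d" "d \<in> F"
      using \<open>b \<in> T\<close> TF by auto
    have sumF: "(\<Sum>c\<in>F. a c *s u c) = 0"
      using sum0 \<open>inj u\<close> unfolding TF by (subst (asm) sum.reindex) (auto simp: a_def inj_on_def inj_def)
    \<comment> \<open>Common denominator: applied to \<open>u c\<close>, the product
      \<open>P F\<close> becomes \<open>P (F - {c})\<close> applied to v, because \<phi> - c maps
      \<open>u c\<close> to v.\<close>
    define P where "P G = (\<Prod>c\<in>G. [:- c, 1:])" for G :: "complex set"
    have "ev (\<Sum>c\<in>F. smult (a c) (P (F - {c}))) v = (\<Sum>c\<in>F. a c *s ev (P F) (u c))"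
      unfolding ev_sum
    proof (rule sum.cong)
      fix c assume "c \<in> F"
      then have "P F = [:- c, 1:] * P (F - {c})"
        unfolding P_def using fin by (rule prod.remove[rotated])
      then show "ev (smult (a c) (P (F - {c}))) v = a c *s ev (P F) (u c)"
        by (simp only: ev_smult ev_linear_factor u)
    qed simp
    also have "\<dots> = ev (P F) (\<Sum>c\<in>F. a c *s u c)"
      by (simp add: ev_sum_right ev_scale_right)
    finally have "ev (\<Sum>c\<in>F. smult (a c) (P (F - {c}))) v = 0"
      by (simp add: sumF ev_zero_right)
    \<comment> \<open>This polynomial kills v, hence is zero; at d every summand with c \<noteq> d
      vanishes, since it contains the factor for d.\<close>
    then have "(\<Sum>c\<in>F. smult (a c) (P (F - {c}))) = 0"
      using ev_inj[OF v(1)] v(2) by blast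
    then have "0 = poly (\<Sum>c\<in>F. smult (a c) (P (F - {c}))) d" by simp
    also have "\<dots> = (\<Sum>c\<in>F. a c * (\<Prod>e\<in>F - {c}. d - e))"
      by (simp add: poly_sum P_def poly_prod)
    also have "\<dots> = (\<Sum>c\<in>{d}. a c * (\<Prod>e\<in>F - {c}. d - e))"
      using fin d by (intro sum.mono_neutral_right) (auto intro!: prod_zero)
    finally have "a d = 0" using fin by auto
    then show "f b = 0" by (simp add: a_def d)
  qed
  \<comment> \<open>Each vector of \<open>range u\<close> lies in the span of a finite subset of B,
    and such a span contains only finitely many members of an independent family; B has countably
    many finite subsets.\<close>
  moreover have "countable (range u)"
  proof -
    have "range u \<subseteq> (\<Union>F\<in>{F. finite F \<and> F \<subseteq> B}. range u \<inter> span F)"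
    proof
      fix x assume x: "x \<in> range u"
      then have "x \<in> span B" using u(1) U(3) by auto
      then obtain F r where "finite F" "F \<subseteq> B" "x = (\<Sum>b\<in>F. r b *s b)"
        unfolding span_explicit by blast
      then have "x \<in> span F" by (auto intro: span_sum span_scale span_base)
      with x \<open>finite F\<close> \<open>F \<subseteq> B\<close> show "x \<in> (\<Union>F\<in>{F. finite F \<and> F \<subseteq> B}. range u \<inter> span F)"
        by blast
    qed
    moreover have "finite (range u \<inter> span F)" if "finite F" for F
    proof -
      have "independent (range u \<inter> span F)"
        using \<open>independent (range u)\<close> independent_mono by blast
      then show ?thesis using independent_span_bound[OF that] by blast
    qed
    then have "countable (\<Union>F\<in>{F. finite F \<and> F \<subseteq> B}. range u \<inter> span F)"
      by (intro countable_UN countable_Collect_finite_subset U(2)) (simp add: countable_finite)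
    ultimately show ?thesis using countable_subset by blast
  qed
  then have "countable (UNIV :: complex set)"
    using \<open>inj u\<close> by (rule countable_image_inj_on)
  then show False using uncountable_UNIV_complex by simp
qed

end

section \<open>The Weyl group\<close>

lemma GL_group: "group (GL :: ('v::real_vector \<Rightarrow> 'v) monoid)"
proof (rule groupI)
  fix x :: "'v \<Rightarrow> 'v" assume "x \<in> carrier GL"
  then have x: "linear x" "bij x" by (auto simp: GL_def)
  then have eq: "inv_into UNIV x a = b \<longleftrightarrow> a = x b" for a b
    by (metis bij_inv_eq_iff)
  have "linear (inv_into UNIV x)"
    by (rule linearI; subst eq) (simp_all add: linear_add[OF x(1)] linear_scale[OF x(1)]
        surj_f_inv_f[OF bij_is_surj[OF x(2)]])
  then show "\<exists>y\<in>carrier GL. y \<otimes>\<^bsub>GL\<^esub> x = \<one>\<^bsub>GL\<^esub>"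
    using x by (intro bexI[of _ "inv_into UNIV x"]) (auto simp: GL_def bij_imp_bij_inv bij_is_inj)
qed (auto simp: GL_def linear_compose bij_comp comp_assoc linear_id[unfolded id_def] bij_id[unfolded id_def] id_def)

definition refl_word :: "('i, 'v::real_vector) root_system \<Rightarrow> 'i list \<Rightarrow> 'v \<Rightarrow> 'v" where
  "refl_word S ws = foldr (\<circ>) (map (simple_refl S) ws) id"

locale root_data =
  fixes S :: "('i, 'v::real_vector) root_system"
  assumes rgs: "root_generating_system S"
begin

abbreviation "I \<equiv> idx S"
abbreviation "rf \<equiv> simple_refl S"
abbreviation "rt \<equiv> simple_root S"
abbreviation "cr \<equiv> simple_coroot S"
abbreviation "Y \<equiv> Y_lattice S"
abbreviation "W \<equiv> weyl_group S"
abbreviation "len \<equiv> weyl_length S"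
abbreviation "word \<equiv> refl_word S"

lemma finite_I: "finite I"
  using rgs by (auto simp: root_generating_system_def Kac_Moody_matrix_def)

lemma Y_lattice_closed: "0 \<in> Y" "\<nu> \<in> Y \<Longrightarrow> \<mu> \<in> Y \<Longrightarrow> \<nu> + \<mu> \<in> Y" "\<nu> \<in> Y \<Longrightarrow> - \<nu> \<in> Y"
proof -
  obtain B where Y: "Y = range (\<lambda>n::'v \<Rightarrow> int. \<Sum>b\<in>B. of_int (n b) *\<^sub>R b)"
    using rgs by (auto simp: root_generating_system_def full_lattice_def)
  show "0 \<in> Y" unfolding Y by (rule range_eqI[of _ _ "\<lambda>_. 0"]) simp
  show "\<nu> + \<mu> \<in> Y" if "\<nu> \<in> Y" "\<mu> \<in> Y"
  proof -
    from that obtain n k :: "'v \<Rightarrow> int" where "\<nu> = (\<Sum>b\<in>B. of_int (n b) *\<^sub>R b)" "\<mu> = (\<Sum>b\<in>B. of_int (k b) *\<^sub>R b)"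
      unfolding Y by blast
    then show ?thesis unfolding Y
      by (intro range_eqI[of _ _ "\<lambda>b. n b + k b"]) (simp add: sum.distrib scaleR_left_distrib)
  qed
  show "- \<nu> \<in> Y" if "\<nu> \<in> Y"
  proof -
    from that obtain n :: "'v \<Rightarrow> int" where "\<nu> = (\<Sum>b\<in>B. of_int (n b) *\<^sub>R b)"
      unfolding Y by blast
    then show ?thesis unfolding Y
      by (intro range_eqI[of _ _ "\<lambda>b. - n b"]) (simp add: sum_negf)
  qed
qed

lemma Y_scale: "\<nu> \<in> Y \<Longrightarrow> of_int k *\<^sub>R \<nu> \<in> Y"
proof (induction k rule: int_induct[of _ 0])
  case (step1 i)
  then show ?case using Y_lattice_closed(2) by (simp add: scaleR_left_distrib)
next
  case (step2 i)
  then show ?case using Y_lattice_closed(2)[of "of_int i *\<^sub>R \<nu>" "- \<nu>"] Y_lattice_closed(3)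
    by (simp add: scaleR_left_diff_distrib)
qed (simp add: Y_lattice_closed)

lemma cr_Y: "i \<in> I \<Longrightarrow> cr i \<in> Y"
  using rgs by (auto simp: root_generating_system_def)

lemma rt_dual: "i \<in> I \<Longrightarrow> rt i \<in> dual_lattice Y"
  using rgs by (auto simp: root_generating_system_def)

lemma rt_linear: "i \<in> I \<Longrightarrow> linear (rt i)"
  using rt_dual by (simp add: dual_lattice_def)

lemma rt_int: "i \<in> I \<Longrightarrow> \<nu> \<in> Y \<Longrightarrow> \<exists>k. rt i \<nu> = of_int k"
  using rt_dual[of i] unfolding dual_lattice_def by (blast elim: Ints_cases)

lemma rt_cr: "i \<in> I \<Longrightarrow> rt i (cr i) = 2"
  using rgs by (auto simp: root_generating_system_def Kac_Moody_matrix_def)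

lemma rf_linear: "i \<in> I \<Longrightarrow> linear (rf i)"
  unfolding simple_refl_def[abs_def] using rt_linear[of i]
  by (intro linearI) (auto simp: linear_add linear_scale algebra_simps)

lemma rf_rf [simp]: "i \<in> I \<Longrightarrow> rf i (rf i v) = v"
  using rt_linear[of i] rt_cr[of i]
  by (simp add: simple_refl_def linear_diff linear_scale algebra_simps)

lemma rf_comp_rf [simp]: "i \<in> I \<Longrightarrow> rf i \<circ> rf i = id"
  by (auto simp: fun_eq_iff)

lemma rf_bij: "i \<in> I \<Longrightarrow> bij (rf i)"
  by (rule o_bij[of "rf i"]) auto

lemma rf_Y: "i \<in> I \<Longrightarrow> \<nu> \<in> Y \<Longrightarrow> rf i \<nu> \<in> Y"
  using rt_int[of i \<nu>] Y_lattice_closed(2)[of \<nu> "- (rt i \<nu> *\<^sub>R cr i)"] Y_lattice_closed(3) Y_scale cr_Y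
  by (auto simp: simple_refl_def)

lemma rf_GL: "i \<in> I \<Longrightarrow> rf i \<in> carrier GL"
  by (simp add: GL_def rf_linear rf_bij)

lemma word_simps [simp]: "word [] = id" "word (i # ws) = rf i \<circ> word ws"
  by (auto simp: refl_word_def)

lemma word_append: "word (ws @ js) = word ws \<circ> word js"
  by (induction ws) (auto simp: comp_assoc)

lemma word_rev: "set ws \<subseteq> I \<Longrightarrow> word ws \<circ> word (rev ws) = id"
proof (induction ws)
  case (Cons i ws)
  have "word (i # ws) \<circ> word (rev (i # ws)) = rf i \<circ> (word ws \<circ> word (rev ws)) \<circ> rf i"
    by (simp add: word_append comp_assoc)
  also have "word ws \<circ> word (rev ws) = id"
    using Cons.IH Cons.prems by (metis insert_subset list.simps(15))
  finally show ?case using Cons.prems by (simp only: comp_id) simp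
qed simp

lemma word_rev': "set ws \<subseteq> I \<Longrightarrow> word (rev ws) \<circ> word ws = id"
  using word_rev[of "rev ws"] by simp

lemma word_linear: "set ws \<subseteq> I \<Longrightarrow> linear (word ws)"
  by (induction ws) (auto intro: linear_compose rf_linear simp: linear_id[unfolded id_def] id_def)

lemma word_bij: "set ws \<subseteq> I \<Longrightarrow> bij (word ws)"
  using word_rev word_rev' by (intro o_bij) auto

lemma word_Y: "set ws \<subseteq> I \<Longrightarrow> \<nu> \<in> Y \<Longrightarrow> word ws \<nu> \<in> Y"
  by (induction ws arbitrary: \<nu>) (auto intro: rf_Y)

lemma inv_word: "set ws \<subseteq> I \<Longrightarrow> inv_into UNIV (word ws) = word (rev ws)"
  using word_rev word_rev' by (metis inv_unique_comp)

text \<open>Every generator is its own inverse, so words in the generators already exhaust the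
  generated group.\<close>

lemma W_words: "W = {word ws | ws. set ws \<subseteq> I}"
proof
  interpret GL: group "GL :: ('v \<Rightarrow> 'v) monoid" by (rule GL_group)
  show "W \<subseteq> {word ws | ws. set ws \<subseteq> I}"
  proof
    fix w assume "w \<in> W"
    then show "w \<in> {word ws | ws. set ws \<subseteq> I}"
      unfolding weyl_group_def
    proof (induction rule: generate.induct)
      case one
      show ?case by (rule CollectI, rule exI[of _ "[]"]) (simp add: GL_def)
    next
      case (incl h)
      then obtain i where "i \<in> I" "h = rf i" by auto
      then show ?case by (intro CollectI exI[of _ "[i]"]) simp
    next
      case (inv h)
      then obtain i where i: "i \<in> I" "h = rf i" by auto
      then have "m_inv GL h = rf i"
        using GL.inv_equality[of "rf i" "rf i"] rf_GL by (simp add: GL_def)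
      with i show ?case by (intro CollectI exI[of _ "[i]"]) simp
    next
      case (eng h1 h2)
      then obtain ws js where "h1 = word ws" "set ws \<subseteq> I" "h2 = word js" "set js \<subseteq> I" by auto
      then show ?case by (intro CollectI exI[of _ "ws @ js"]) (simp add: word_append GL_def)
    qed
  qed
  have "word ws \<in> W" if "set ws \<subseteq> I" for ws
    using that
  proof (induction ws)
    case Nil
    have "\<one>\<^bsub>GL\<^esub> \<in> W" unfolding weyl_group_def by (rule generate.one)
    then show ?case by (simp add: GL_def id_def)
  next
    case (Cons i ws)
    then have "rf i \<otimes>\<^bsub>GL\<^esub> word ws \<in> W"
      unfolding weyl_group_def by (intro generate.eng[OF generate.incl]) auto
    then show ?case by (simp add: GL_def comp_def)
  qed
  then show "{word ws | ws. set ws \<subseteq> I} \<subseteq> W" by auto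
qed

lemma W_id: "id \<in> W"
  unfolding W_words by (intro CollectI exI[of _ "[]"]) simp

lemma W_rf: "i \<in> I \<Longrightarrow> rf i \<in> W"
  unfolding W_words by (intro CollectI exI[of _ "[i]"]) simp

lemma W_comp: "v \<in> W \<Longrightarrow> w \<in> W \<Longrightarrow> v \<circ> w \<in> W"
  unfolding W_words by clarsimp (metis word_append set_append Un_least)

lemma W_inv: "w \<in> W \<Longrightarrow> inv_into UNIV w \<in> W"
  unfolding W_words by clarsimp (metis inv_word set_rev)

lemma W_linear: "w \<in> W \<Longrightarrow> linear w"
  and W_bij: "w \<in> W \<Longrightarrow> bij w"
  and W_Y: "w \<in> W \<Longrightarrow> \<nu> \<in> Y \<Longrightarrow> w \<nu> \<in> Y"
  unfolding W_words by (auto intro: word_linear word_bij word_Y)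

lemma W_inv_Y: "w \<in> W \<Longrightarrow> \<nu> \<in> Y \<Longrightarrow> inv_into UNIV w \<nu> \<in> Y"
  using W_inv W_Y by blast

lemma W_GL: "w \<in> W \<Longrightarrow> w \<in> carrier GL"
  by (simp add: GL_def W_linear W_bij)

lemma W_comp_inv [simp]: "w \<in> W \<Longrightarrow> inv_into UNIV w \<circ> w = id" "w \<in> W \<Longrightarrow> w \<circ> inv_into UNIV w = id"
    "w \<in> W \<Longrightarrow> inv_into UNIV w (w v) = v" "w \<in> W \<Longrightarrow> w (inv_into UNIV w v) = v"
  using W_bij[of w] by (auto simp: bij_is_inj bij_is_surj surj_iff surj_f_inv_f)

lemma countable_W: "countable W"
proof -
  have "W = word ` lists I" by (auto simp: W_words lists_eq_set)
  then show ?thesis using finite_I by (simp add: countable_lists countable_finite)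
qed

lemma len_word: "set ws \<subseteq> I \<Longrightarrow> len (word ws) \<le> length ws"
  unfolding weyl_length_def by (rule Least_le) (auto simp: refl_word_def)

lemma reduced_word:
  assumes "w \<in> W"
  obtains ws where "set ws \<subseteq> I" "w = word ws" "length ws = len w"
proof -
  obtain js where "set js \<subseteq> I" "w = word js" using assms W_words by auto
  then have "\<exists>n ws. length ws = n \<and> set ws \<subseteq> I \<and> w = foldr (\<circ>) (map rf ws) id"
    by (auto simp: refl_word_def)
  from LeastI_ex[OF this] show thesis
    using that unfolding weyl_length_def refl_word_def by blast
qed

lemma len_id [simp]: "len id = 0"
  using len_word[of "[]"] by simp

lemma len_eq_0: "w \<in> W \<Longrightarrow> len w = 0 \<Longrightarrow> w = id"
  by (elim reduced_word) auto

text \<open>The determinant of a word is -1 to the power of its number of letters, so any two words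
  for one element have lengths of equal parity.\<close>

lemma len_parity: "set ws \<subseteq> I \<Longrightarrow> even (len (word ws)) \<longleftrightarrow> even (length ws)"
proof -
  assume "set ws \<subseteq> I"
  then have "word ws \<in> W" using W_words by auto
  then obtain js where js: "set js \<subseteq> I" "word ws = word js" "length js = len (word ws)"
    using reduced_word by blast
  obtain B :: "'v set" where "finite B" "independent B" "span B = UNIV"
    using rgs by (auto simp: root_generating_system_def full_lattice_def)
  then show "even (len (word ws)) \<longleftrightarrow> even (length ws)"
  proof (rule ex_determinant_of_reflections)
    fix d :: "('v \<Rightarrow> 'v) \<Rightarrow> real"
    assume d: "d id = 1"
      "\<And>f g. linear f \<Longrightarrow> linear g \<Longrightarrow> d (f \<circ> g) = d f * d g"
      "\<And>\<alpha> u. linear \<alpha> \<Longrightarrow> \<alpha> u = 2 \<Longrightarrow> d (\<lambda>v. v - \<alpha> v *\<^sub>R u) = -1"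
    have rf: "d (rf i) = -1" if "i \<in> I" for i
      unfolding simple_refl_def[abs_def] using that by (intro d rt_linear rt_cr)
    have "d (word ks) = (-1) ^ length ks" if "set ks \<subseteq> I" for ks
      using that by (induction ks) (auto simp: d rf rf_linear word_linear)
    from this[of ws] this[of js] js \<open>set ws \<subseteq> I\<close> show ?thesis
      by (metis neg_one_even_power neg_one_odd_power one_neq_neg_one)
  qed
qed

text \<open>The lengths differ by at most one and parity rules out equality. Hence the two clauses
  for the product of \<open>Hb (rf i)\<close> and \<open>Hb w\<close> cover every w.\<close>

lemma len_rf_comp:
  assumes i: "i \<in> I" and w: "w \<in> W"
  shows "len (rf i \<circ> w) = len w + 1 \<or> len w = len (rf i \<circ> w) + 1"
proof -
  have *: "len (rf i \<circ> v) \<le> len v + 1" "even (len (rf i \<circ> v)) \<longleftrightarrow> odd (len v)" if v: "v \<in> W" for v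
  proof -
    obtain js where js: "set js \<subseteq> I" "v = word js" "length js = len v"
      using reduced_word[OF v] by blast
    show "len (rf i \<circ> v) \<le> len v + 1"
      using len_word[of "i # js"] js i by simp
    show "even (len (rf i \<circ> v)) \<longleftrightarrow> odd (len v)"
      using len_parity[of "i # js"] js i by simp
  qed
  have "rf i \<circ> (rf i \<circ> w) = w"
    using i by (auto simp: fun_eq_iff)
  then have "len w \<le> len (rf i \<circ> w) + 1"
    using *(1)[of "rf i \<circ> w"] W_comp[OF W_rf[OF i] w] by simp
  moreover have "a \<le> b + 1 \<Longrightarrow> even a = odd b \<Longrightarrow> b \<le> a + 1 \<Longrightarrow> a = b + 1 \<or> b = a + 1" for a b :: nat
    by presburger
  ultimately show ?thesis using *[OF w] by blast
qed

text \<open>Removes the first letter of a reduced word. Each step increases the length, so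
  \<open>Hb (rf i \<circ> w)\<close> splits as a product by \<open>Hb_up\<close> alone.\<close>

lemma W_induct [consumes 1, case_names id step]:
  assumes "w \<in> W" and "P id"
    and step: "\<And>i w. i \<in> I \<Longrightarrow> w \<in> W \<Longrightarrow> len (rf i \<circ> w) = len w + 1 \<Longrightarrow> P w \<Longrightarrow> P (rf i \<circ> w)"
  shows "P w"
  using assms(1)
proof (induction "len w" arbitrary: w)
  case 0
  then show ?case using len_eq_0 assms(2) by auto
next
  case (Suc n)
  obtain ws where ws: "set ws \<subseteq> I" "w = word ws" "length ws = len w"
    using reduced_word[OF Suc.prems] by blast
  with Suc.hyps(2) obtain i js where js: "ws = i # js" by (cases ws) auto
  with ws have *: "i \<in> I" "set js \<subseteq> I" "w = rf i \<circ> word js" by auto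
  then have "word js \<in> W" using W_words by auto
  moreover have "len (word js) = n"
    using len_word[of js] len_rf_comp[of i "word js"] ws js * Suc.hyps(2) \<open>word js \<in> W\<close> by auto
  ultimately show ?case
    using step[of i "word js"] Suc.hyps * by auto
qed

lemma len_rf: "i \<in> I \<Longrightarrow> len (rf i) = 1"
  using len_rf_comp[of i id] W_id by simp

end

section \<open>The Bernstein--Lusztig--Hecke algebra\<close>

lemma lookup_hscale [simp]: "Poly_Mapping.lookup (hscale c f) k = c * Poly_Mapping.lookup f k"
  by (simp add: hscale_def Poly_Mapping.map.rep_eq when_def)

global_interpretation hv: vector_space hscale
  by unfold_locales (auto intro!: poly_mapping_eqI simp: lookup_add algebra_simps)

global_interpretation hp: vector_space_pair hscale hscale ..

abbreviation hlinear :: "('v hecke \<Rightarrow> 'v hecke) \<Rightarrow> bool" where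
  "hlinear \<equiv> Vector_Spaces.linear hscale hscale"

text \<open>One family of coordinate subspaces serves for the whole algebra, for C[Y], for the span
  of the \<open>H\<^sub>w\<close> and for the filtration by length.\<close>

definition hsp :: "('v \<times> ('v \<Rightarrow> 'v)) set \<Rightarrow> 'v hecke set" where
  "hsp K = {f. Poly_Mapping.keys f \<subseteq> K}"

lemma subspace_hsp: "hv.subspace (hsp K)"
proof (rule hv.subspaceI)
  show "x + y \<in> hsp K" if "x \<in> hsp K" "y \<in> hsp K" for x y
    using that keys_add[of x y] by (auto simp: hsp_def)
  show "hscale c x \<in> hsp K" if "x \<in> hsp K" for c x
    using that by (auto simp: hsp_def in_keys_iff)
qed (simp add: hsp_def)

lemmas hsp_add = hv.subspace_add[OF subspace_hsp]
  and hsp_diff = hv.subspace_diff[OF subspace_hsp]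
  and hsp_scale = hv.subspace_scale[OF subspace_hsp]
  and hsp_0 = hv.subspace_0[OF subspace_hsp]

lemma lookup_ZH: "Poly_Mapping.lookup (ZH \<nu> w) (\<mu>, v) = (if \<nu> = \<mu> \<and> w = v then 1 else 0)"
  by (auto simp: ZH_def lookup_single when_def)

lemma ZH_in_hsp: "(\<nu>, w) \<in> K \<Longrightarrow> ZH \<nu> w \<in> hsp K"
  by (auto simp: hsp_def ZH_def)

lemma hsp_mono: "K \<subseteq> L \<Longrightarrow> hsp K \<subseteq> hsp L"
  by (auto simp: hsp_def)

lemma hsp_lookup: "f \<in> hsp K \<Longrightarrow> k \<notin> K \<Longrightarrow> Poly_Mapping.lookup f k = 0"
  by (auto simp: hsp_def in_keys_iff)

lemma hsp_span: "hsp K = hv.span ((\<lambda>(\<nu>, w). ZH \<nu> w) ` K)"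
proof
  show "hv.span ((\<lambda>(\<nu>, w). ZH \<nu> w) ` K) \<subseteq> hsp K"
    by (rule hv.span_minimal) (auto intro: ZH_in_hsp subspace_hsp)
  show "hsp K \<subseteq> hv.span ((\<lambda>(\<nu>, w). ZH \<nu> w) ` K)"
  proof
    fix f :: "'a hecke" assume f: "f \<in> hsp K"
    have single: "Poly_Mapping.single k c = hscale c (case k of (\<nu>, w) \<Rightarrow> ZH \<nu> w)" for k :: "'a \<times> ('a \<Rightarrow> 'a)" and c
      by (rule poly_mapping_eqI) (auto simp: lookup_single lookup_ZH when_def split: prod.split)
    have "f = (\<Sum>k\<in>Poly_Mapping.keys f. Poly_Mapping.single k (Poly_Mapping.lookup f k))"
      by (rule poly_mapping_eqI) (auto simp: lookup_sum lookup_single when_def in_keys_iff)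
    also have "\<dots> \<in> hv.span ((\<lambda>(\<nu>, w). ZH \<nu> w) ` K)"
      unfolding single using f
      by (intro hv.span_sum hv.span_scale hv.span_base) (auto simp: hsp_def)
    finally show "f \<in> hv.span ((\<lambda>(\<nu>, w). ZH \<nu> w) ` K)" .
  qed
qed

lemma hsp_induct [consumes 1, case_names zero add scale ZH]:
  assumes "f \<in> hsp K" "P 0" "\<And>a b. P a \<Longrightarrow> P b \<Longrightarrow> P (a + b)" "\<And>c a. P a \<Longrightarrow> P (hscale c a)"
    and "\<And>\<nu> w. (\<nu>, w) \<in> K \<Longrightarrow> P (ZH \<nu> w)"
  shows "P f"
proof -
  have "hv.subspace (Collect P)"
    by (rule hv.subspaceI) (use assms in auto)
  moreover have "(\<lambda>(\<nu>, w). ZH \<nu> w) ` K \<subseteq> Collect P"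
    using assms(5) by auto
  ultimately show ?thesis
    using hv.span_minimal assms(1) unfolding hsp_span by blast
qed

section \<open>Linear extension of characters\<close>

lemma char_ext_superset:
  assumes "finite A" "Poly_Mapping.keys f \<subseteq> A"
  shows "char_ext \<chi> f = (\<Sum>k\<in>A. Poly_Mapping.lookup f k * \<chi> (fst k))"
  unfolding char_ext_def using assms by (intro sum.mono_neutral_left) (auto simp: in_keys_iff)

lemma char_ext_add: "char_ext \<chi> (f + g) = char_ext \<chi> f + char_ext \<chi> g"
proof -
  let ?A = "Poly_Mapping.keys f \<union> Poly_Mapping.keys g"
  show ?thesis
    using keys_add[of f g]
    by (simp add: char_ext_superset[of ?A] lookup_add sum.distrib algebra_simps)
qed

lemma char_ext_scale: "char_ext \<chi> (hscale c f) = c * char_ext \<chi> f"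
proof -
  have "Poly_Mapping.keys (hscale c f) \<subseteq> Poly_Mapping.keys f"
    by (auto simp: in_keys_iff)
  then show ?thesis
    by (subst (1 2) char_ext_superset[of "Poly_Mapping.keys f"])
      (auto simp: sum_distrib_left algebra_simps)
qed

lemma char_ext_ZH [simp]: "char_ext \<chi> (ZH \<nu> w) = \<chi> \<nu>"
  by (simp add: char_ext_def ZH_def)

lemma char_ext_0 [simp]: "char_ext \<chi> 0 = 0"
  by (simp add: char_ext_def)

lemma char_ext_diff: "char_ext \<chi> (f - g) = char_ext \<chi> f - char_ext \<chi> g"
  using char_ext_add[of \<chi> "f - g" g] by simp

locale hecke_algebra = root_data S for S :: "('i, 'v::real_vector) root_system" +
  fixes q :: nat and m :: "'v hecke \<Rightarrow> 'v hecke \<Rightarrow> 'v hecke"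
  assumes BLH: "BLH_product S q m" and q_ge_2: "2 \<le> q"
begin

abbreviation "V \<equiv> hsp (Y \<times> W)"
abbreviation "A \<equiv> hsp (Y \<times> {id :: 'v \<Rightarrow> 'v})"
abbreviation "HW \<equiv> hsp ({0} \<times> W)"

definition hc :: complex where
  "hc = complex_of_real (sqrt (real q) - inverse (sqrt (real q)))"

lemma V_eq: "hecke_space S = V" and A_eq: "group_algebra S = A"
  by (auto simp: hecke_space_def group_algebra_def hsp_def)

lemma A_V: "A \<subseteq> V" and HW_V: "HW \<subseteq> V"
  using W_id Y_lattice_closed by (auto intro!: hsp_mono)

text \<open>The given product is only constrained on V; precomposing it with the coordinate projection
  onto V makes all identities unconditional.\<close>

definition proj :: "'v hecke \<Rightarrow> 'v hecke" where
  "proj f = Poly_Mapping.mapp (\<lambda>k x. if k \<in> Y \<times> W then x else 0) f"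

lemma lookup_proj: "Poly_Mapping.lookup (proj f) k = (if k \<in> Y \<times> W then Poly_Mapping.lookup f k else 0)"
  by (auto simp: proj_def lookup_mapp in_keys_iff when_def)

lemma proj_V: "proj f \<in> V"
  by (auto simp: hsp_def in_keys_iff lookup_proj split: if_splits)

lemma proj_id: "f \<in> V \<Longrightarrow> proj f = f"
  by (rule poly_mapping_eqI) (auto simp: lookup_proj hsp_lookup)

lemma proj_add: "proj (f + g) = proj f + proj g"
  and proj_scale: "proj (hscale c f) = hscale c (proj f)"
  by (auto intro!: poly_mapping_eqI simp: lookup_proj lookup_add)

definition mul :: "'v hecke \<Rightarrow> 'v hecke \<Rightarrow> 'v hecke" (infixl "\<star>" 70) where
  "a \<star> b = m (proj a) (proj b)"

lemma bilin: "bilinear_assoc_on V m"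
  using BLH by (simp add: BLH_product_def Let_def V_eq)

lemma mul_eq: "a \<in> V \<Longrightarrow> b \<in> V \<Longrightarrow> a \<star> b = m a b"
  by (simp add: mul_def proj_id)

lemma mul_V: "a \<star> b \<in> V"
  using bilin proj_V by (auto simp: bilinear_assoc_on_def mul_def)

lemma mul_assoc: "a \<star> b \<star> c = a \<star> (b \<star> c)"
  using bilin proj_V proj_id[OF mul_V, of a b] proj_id[OF mul_V, of b c]
  unfolding bilinear_assoc_on_def by (simp add: mul_def)

lemma mul_add_left: "(a + b) \<star> c = a \<star> c + b \<star> c"
  and mul_add_right: "a \<star> (b + c) = a \<star> b + a \<star> c"
  and mul_scale_left: "hscale x a \<star> b = hscale x (a \<star> b)"
  and mul_scale_right: "a \<star> hscale x b = hscale x (a \<star> b)"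
  using bilin proj_V unfolding bilinear_assoc_on_def by (auto simp: mul_def proj_add proj_scale)

lemma linear_mul_left: "hlinear (\<lambda>a. a \<star> b)"
  and linear_mul_right: "hlinear (\<lambda>b. a \<star> b)"
  by (auto simp: mul_add_left mul_add_right mul_scale_left mul_scale_right hv.vector_space_axioms Vector_Spaces.linear_iff)

lemma mul_zero [simp]: "0 \<star> a = 0" "a \<star> 0 = 0"
  using hp.linear_0[OF linear_mul_left] hp.linear_0[OF linear_mul_right] .

lemma mul_diff_left: "(a - b) \<star> c = a \<star> c - b \<star> c"
  and mul_diff_right: "a \<star> (b - c) = a \<star> b - a \<star> c"
  using hp.linear_diff[OF linear_mul_left] hp.linear_diff[OF linear_mul_right] .

lemmas mul_lin = mul_add_left mul_add_right mul_scale_left mul_scale_right mul_diff_left mul_diff_right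

lemma ZH_V: "\<nu> \<in> Y \<Longrightarrow> w \<in> W \<Longrightarrow> ZH \<nu> w \<in> V"
  by (simp add: ZH_in_hsp)

lemma Zb_Hb: "\<nu> \<in> Y \<Longrightarrow> w \<in> W \<Longrightarrow> Zb \<nu> \<star> Hb w = ZH \<nu> w"
  using BLH by (simp add: BLH_product_def Let_def mul_eq ZH_V Y_lattice_closed W_id)

lemma Zb_Zb: "\<nu> \<in> Y \<Longrightarrow> \<mu> \<in> Y \<Longrightarrow> Zb \<nu> \<star> Zb \<mu> = Zb (\<nu> + \<mu>)"
  using BLH by (simp add: BLH_product_def Let_def mul_eq ZH_V Y_lattice_closed W_id)

lemma Hb_up: "i \<in> I \<Longrightarrow> w \<in> W \<Longrightarrow> len (rf i \<circ> w) = len w + 1 \<Longrightarrow> Hb (rf i) \<star> Hb w = Hb (rf i \<circ> w)"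
  using BLH by (simp add: BLH_product_def Let_def mul_eq ZH_V Y_lattice_closed W_rf)

lemma Hb_down: "i \<in> I \<Longrightarrow> w \<in> W \<Longrightarrow> len w = len (rf i \<circ> w) + 1
    \<Longrightarrow> Hb (rf i) \<star> Hb w = hscale hc (Hb w) + Hb (rf i \<circ> w)"
  using BLH by (simp add: BLH_product_def Let_def mul_eq ZH_V Y_lattice_closed W_rf hc_def)

text \<open>The quotient is kept as an element D with its defining equation; a character whose value
  at the coroot is not 1 can then be evaluated on D by division.\<close>

lemma BL_relation:
  assumes "i \<in> I" "\<nu> \<in> Y"
  obtains D where "D \<in> A" "(Zb 0 - Zb (- cr i)) \<star> D = Zb \<nu> - Zb (rf i \<nu>)"
    "Hb (rf i) \<star> Zb \<nu> = Zb (rf i \<nu>) \<star> Hb (rf i) + hscale hc D"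
proof -
  obtain D where "D \<in> A" "m (Zb 0 - Zb (- cr i)) D = Zb \<nu> - Zb (rf i \<nu>)"
    "m (Hb (rf i)) (Zb \<nu>) - m (Zb (rf i \<nu>)) (Hb (rf i)) = hscale hc D"
    using BLH assms by (fastforce simp: BLH_product_def Let_def A_eq hc_def)
  moreover have "Zb 0 - Zb (- cr i) \<in> V" "D \<in> V"
    using assms A_V \<open>D \<in> A\<close> by (auto intro!: hsp_diff ZH_V Y_lattice_closed cr_Y W_id)
  ultimately show thesis
    using that[of D] assms
    by (simp add: mul_eq ZH_V W_id W_rf Y_lattice_closed rf_Y diff_eq_eq add.commute)
qed

lemma one_V: "Zb 0 \<in> V" and one_HW: "Zb 0 \<in> HW" and one_A: "Zb 0 \<in> A"
  by (auto intro: ZH_in_hsp simp: Y_lattice_closed W_id)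

text \<open>The unit law is derived: once \<open>ZH \<nu> w\<close> is written as a product,
  associativity reduces it to \<open>Zb_Zb\<close>.\<close>

lemma one_left: "a \<in> V \<Longrightarrow> Zb 0 \<star> a = a"
proof (induction rule: hsp_induct)
  case (ZH \<nu> w)
  then have "Zb 0 \<star> (Zb \<nu> \<star> Hb w) = Zb \<nu> \<star> Hb w"
    by (subst mul_assoc[symmetric], subst Zb_Zb) (auto simp: Y_lattice_closed)
  with ZH have "Zb 0 \<star> ZH \<nu> w = ZH \<nu> w" by (simp add: Zb_Hb)
  then show ?case .
qed (auto simp: mul_lin)

lemma Hb_one: "w \<in> W \<Longrightarrow> Hb w \<star> Zb 0 = Hb w"
proof (induction rule: W_induct)
  case id
  have "Zb 0 \<star> Zb 0 = Zb 0" by (simp add: one_left one_V)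
  then show ?case .
next
  case (step i w)
  have "Hb (rf i) \<star> Hb w \<star> Zb 0 = Hb (rf i) \<star> (Hb w \<star> Zb 0)"
    by (rule mul_assoc)
  moreover have "Hb w \<star> Zb 0 = Hb w" by (rule step)
  ultimately have "Hb (rf i \<circ> w) \<star> Zb 0 = Hb (rf i \<circ> w)"
    using step(1-3) by (simp add: Hb_up)
  then show ?case .
qed

lemma one_right: "a \<in> V \<Longrightarrow> a \<star> Zb 0 = a"
proof (induction rule: hsp_induct)
  case (ZH \<nu> w)
  then have "(Zb \<nu> \<star> Hb w) \<star> Zb 0 = Zb \<nu> \<star> Hb w"
    by (subst mul_assoc) (simp add: Hb_one)
  with ZH have "ZH \<nu> w \<star> Zb 0 = ZH \<nu> w" by (simp add: Zb_Hb)
  then show ?case .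
qed (auto simp: mul_lin)

lemma Hb_rf_sq: "i \<in> I \<Longrightarrow> Hb (rf i) \<star> Hb (rf i) = hscale hc (Hb (rf i)) + Zb 0"
  using Hb_down[of i "rf i"] by (simp add: W_rf len_rf)

lemma char_ext_mul:
  assumes \<chi>: "torus_character S \<chi>" and "a \<in> A" "b \<in> A"
  shows "char_ext \<chi> (a \<star> b) = char_ext \<chi> a * char_ext \<chi> b"
  using assms(2)
proof (induction rule: hsp_induct)
  case (ZH \<nu> w)
  then have \<nu>: "w = id" "\<nu> \<in> Y" by auto
  from assms(3) show ?case
  proof (induction rule: hsp_induct)
    case (ZH \<mu> v)
    then have "char_ext \<chi> (Zb \<nu> \<star> Zb \<mu>) = \<chi> \<nu> * \<chi> \<mu>"
      using \<chi> \<nu> by (auto simp: Zb_Zb torus_character_def)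
    moreover have "v = id" using ZH by auto
    ultimately have "char_ext \<chi> (ZH \<nu> w \<star> ZH \<mu> v) = char_ext \<chi> (ZH \<nu> w) * char_ext \<chi> (ZH \<mu> v)"
      using \<nu> by simp
    then show ?case .
  qed (auto simp: mul_lin char_ext_add char_ext_scale algebra_simps)
qed (auto simp: mul_lin char_ext_add char_ext_scale algebra_simps)

lemma char_one: "torus_character S \<chi> \<Longrightarrow> \<chi> 0 = 1"
  unfolding torus_character_def using Y_lattice_closed(1)
  by (metis add_0 mult_cancel_right2)

lemma char_uminus: "torus_character S \<chi> \<Longrightarrow> \<nu> \<in> Y \<Longrightarrow> \<chi> (- \<nu>) = inverse (\<chi> \<nu>)"
  using char_one[of \<chi>] Y_lattice_closed(3)[of \<nu>] unfolding torus_character_def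
  by (metis add.right_inverse inverse_unique)

lemma Hb_rf_HW: "i \<in> I \<Longrightarrow> h \<in> HW \<Longrightarrow> Hb (rf i) \<star> h \<in> HW"
proof (rotate_tac, induction rule: hsp_induct)
  case (ZH \<nu> w)
  then have w: "\<nu> = 0" "w \<in> W" "rf i \<circ> w \<in> W" by (auto intro: W_comp W_rf)
  have "Hb w \<in> HW" "Hb (rf i \<circ> w) \<in> HW" using w by (auto intro: ZH_in_hsp)
  then show ?case
    using len_rf_comp[OF ZH(2) w(2)] w ZH(2)
    by (auto simp: Hb_up Hb_down intro!: hsp_add hsp_scale)
qed (auto simp: mul_lin intro: hsp_add hsp_scale hsp_0)

lemma HW_mul: "a \<in> HW \<Longrightarrow> b \<in> HW \<Longrightarrow> a \<star> b \<in> HW"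
proof (induction rule: hsp_induct)
  case (ZH \<nu> w)
  then have "\<nu> = 0" "w \<in> W" by auto
  from this(2) have "Hb w \<star> b \<in> HW"
  proof (induction rule: W_induct)
    case id
    have "Zb 0 \<star> b \<in> HW" using ZH one_left HW_V by auto
    then show ?case .
  next
    case (step i w)
    then have "Hb (rf i \<circ> w) \<star> b = Hb (rf i) \<star> (Hb w \<star> b)"
      by (simp add: Hb_up[symmetric] mul_assoc)
    with step have "Hb (rf i \<circ> w) \<star> b \<in> HW" by (simp add: Hb_rf_HW)
    then show ?case .
  qed
  with \<open>\<nu> = 0\<close> show ?case by simp
qed (auto simp: mul_lin intro: hsp_add hsp_scale hsp_0)

text \<open>Multiplying by C[Y] from the left shifts only the lattice coordinate, so any restriction
  U on the Weyl group coordinate survives.\<close>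

lemma A_mul: "\<theta> \<in> A \<Longrightarrow> U \<subseteq> W \<Longrightarrow> a \<in> hsp (Y \<times> U) \<Longrightarrow> \<theta> \<star> a \<in> hsp (Y \<times> U)"
proof (induction rule: hsp_induct)
  case (ZH \<nu> w)
  then have \<nu>: "w = id" "\<nu> \<in> Y" by auto
  from ZH(3,2) show ?case
  proof (induction rule: hsp_induct)
    case (ZH \<mu> v)
    then have "v \<in> W" by auto
    then have "Zb \<nu> \<star> ZH \<mu> v = ZH (\<nu> + \<mu>) v"
      using \<nu> ZH Zb_Hb[of \<mu> v] Zb_Hb[of "\<nu> + \<mu>" v] Zb_Zb[of \<nu> \<mu>] Y_lattice_closed(2)
      by (metis mul_assoc mem_Sigma_iff)
    then have "Zb \<nu> \<star> ZH \<mu> v \<in> hsp (Y \<times> U)"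
      using ZH \<nu> by (auto intro: ZH_in_hsp Y_lattice_closed)
    with \<nu> show ?case by blast
  qed (auto simp: mul_lin intro: hsp_add hsp_scale hsp_0)
qed (auto simp: mul_lin intro: hsp_add hsp_scale hsp_0)

text \<open>Moving \<open>Hb (rf i)\<close> past \<open>Zb \<nu>\<close> reflects the exponent; the
  correction from the Bernstein--Lusztig relation leaves the Weyl group coordinate w
  unchanged.\<close>

lemma Hb_rf_ZH:
  assumes i: "i \<in> I" and \<nu>: "\<nu> \<in> Y" and w: "w \<in> W"
  shows "Hb (rf i) \<star> ZH \<nu> w - Zb (rf i \<nu>) \<star> (Hb (rf i) \<star> Hb w) \<in> hsp (Y \<times> {w})"
proof -
  obtain D where D: "D \<in> A" "Hb (rf i) \<star> Zb \<nu> = Zb (rf i \<nu>) \<star> Hb (rf i) + hscale hc D"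
    using BL_relation[OF i \<nu>] by metis
  have "Hb (rf i) \<star> ZH \<nu> w = (Hb (rf i) \<star> Zb \<nu>) \<star> Hb w"
    using \<nu> w by (simp add: Zb_Hb mul_assoc)
  also have "\<dots> = Zb (rf i \<nu>) \<star> (Hb (rf i) \<star> Hb w) + hscale hc (D \<star> Hb w)"
    by (simp add: D mul_lin mul_assoc)
  finally show ?thesis
    using A_mul[OF D(1), of "{w}" "Hb w"] w
    by (auto intro!: hsp_scale ZH_in_hsp Y_lattice_closed)
qed

abbreviation "shorter n \<equiv> hsp (Y \<times> {v \<in> W. len v < n})"

lemma Hb_rf_shorter: "i \<in> I \<Longrightarrow> a \<in> shorter n \<Longrightarrow> Hb (rf i) \<star> a \<in> shorter (Suc n)"
proof (rotate_tac, induction rule: hsp_induct)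
  case (ZH \<nu> w)
  then have w: "\<nu> \<in> Y" "w \<in> W" "len w < n" by auto
  let ?r = "rf i \<circ> w"
  have r: "?r \<in> W" using w ZH by (auto intro: W_comp W_rf)
  have r': "len ?r < Suc n" using len_rf_comp[OF ZH(2) w(2)] w(3) by auto
  have "Hb w \<in> shorter (Suc n)" "Hb ?r \<in> shorter (Suc n)"
    using w r r' by (auto intro!: ZH_in_hsp Y_lattice_closed)
  then have "Hb (rf i) \<star> Hb w \<in> shorter (Suc n)"
    using len_rf_comp[OF ZH(2) w(2)] w ZH(2)
    by (auto simp: Hb_up Hb_down intro!: hsp_add hsp_scale)
  then have "Zb (rf i \<nu>) \<star> (Hb (rf i) \<star> Hb w) \<in> shorter (Suc n)"
    using w ZH by (intro A_mul[of "Zb (rf i \<nu>)" "{v \<in> W. len v < Suc n}"] ZH_in_hsp) (auto intro: rf_Y)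
  moreover have "hsp (Y \<times> {w}) \<subseteq> shorter (Suc n)"
    using w by (intro hsp_mono) auto
  then have "Hb (rf i) \<star> ZH \<nu> w - Zb (rf i \<nu>) \<star> (Hb (rf i) \<star> Hb w) \<in> shorter (Suc n)"
    using Hb_rf_ZH[OF ZH(2) w(1,2)] by blast
  ultimately have "Hb (rf i) \<star> ZH \<nu> w - Zb (rf i \<nu>) \<star> (Hb (rf i) \<star> Hb w)
      + Zb (rf i \<nu>) \<star> (Hb (rf i) \<star> Hb w) \<in> shorter (Suc n)"
    by (intro hsp_add)
  then show ?case by simp
qed (auto simp: mul_lin intro: hsp_add hsp_scale hsp_0)

text \<open>Triangularity with respect to length. In the inductive step \<open>Hb_up\<close> carries
  the leading term along, and the new correction sits at w, which is shorter than
  \<open>rf i \<circ> w\<close>.\<close>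

lemma Hb_Zb_leading:
  "w \<in> W \<Longrightarrow> \<nu> \<in> Y \<Longrightarrow> Hb w \<star> Zb \<nu> - ZH (w \<nu>) w \<in> shorter (len w)"
proof (induction arbitrary: \<nu> rule: W_induct)
  case id
  then have "Zb 0 \<star> Zb \<nu> - ZH (id \<nu>) id \<in> shorter (len id)"
    by (simp add: one_left ZH_V W_id hsp_0)
  then show ?case .
next
  case (step i w)
  note \<nu> = W_Y[OF \<open>w \<in> W\<close> \<open>\<nu> \<in> Y\<close>]
  let ?L = "Hb w \<star> Zb \<nu> - ZH (w \<nu>) w"
  let ?M = "Hb (rf i) \<star> ZH (w \<nu>) w - Zb (rf i (w \<nu>)) \<star> (Hb (rf i) \<star> Hb w)"
  have "Hb (rf i \<circ> w) \<star> Zb \<nu> = Hb (rf i) \<star> (Hb w \<star> Zb \<nu>)"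
    using step by (simp add: Hb_up[symmetric] mul_assoc)
  moreover have "Zb (rf i (w \<nu>)) \<star> (Hb (rf i) \<star> Hb w) = ZH ((rf i \<circ> w) \<nu>) (rf i \<circ> w)"
    using step \<nu> by (simp add: Hb_up Zb_Hb rf_Y W_comp W_rf)
  ultimately have "Hb (rf i \<circ> w) \<star> Zb \<nu> - ZH ((rf i \<circ> w) \<nu>) (rf i \<circ> w) = Hb (rf i) \<star> ?L + ?M"
    by (simp add: mul_lin)
  moreover have "Hb (rf i) \<star> ?L \<in> shorter (len (rf i \<circ> w))"
  proof -
    have "?L \<in> shorter (len w)" using \<open>\<nu> \<in> Y\<close> by (rule step)
    then show ?thesis using step(1,3) by (simp add: Hb_rf_shorter)
  qed
  moreover have "hsp (Y \<times> {w}) \<subseteq> shorter (len (rf i \<circ> w))"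
    using step by (intro hsp_mono) auto
  then have "?M \<in> shorter (len (rf i \<circ> w))"
    using Hb_rf_ZH[OF step(1) \<nu> step(2)] by blast
  ultimately have "Hb (rf i \<circ> w) \<star> Zb \<nu> - ZH ((rf i \<circ> w) \<nu>) (rf i \<circ> w) \<in> shorter (len (rf i \<circ> w))"
    by (simp only: hsp_add)
  then show ?case .
qed

end

section \<open>The principal series module\<close>

context hecke_algebra
begin

text \<open>Products in the order adapted to the right action of C[Y], over which the induced module
  is formed.\<close>

definition TB :: "'v \<times> ('v \<Rightarrow> 'v) \<Rightarrow> 'v hecke" where
  "TB k = Hb (snd k) \<star> Zb (fst k)"

text \<open>The lower terms of \<open>TB (\<nu>, v)\<close> have Weyl group coordinate shorter than
  v, so at a w that is at least as long only the leading term is visible.\<close>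

lemma lookup_TB:
  assumes "\<nu> \<in> Y" "v \<in> W" "len v \<le> len w"
  shows "Poly_Mapping.lookup (TB (\<nu>, v)) (\<mu>, w) = (if v = w \<and> v \<nu> = \<mu> then 1 else 0)"
proof -
  have "Poly_Mapping.lookup (TB (\<nu>, v) - ZH (v \<nu>) v) (\<mu>, w) = 0"
    using Hb_Zb_leading[OF assms(2,1)] assms(3) by (intro hsp_lookup) (auto simp: TB_def)
  then show ?thesis by (auto simp: lookup_minus lookup_ZH)
qed

lemma TB_V: "TB k \<in> V"
  by (simp add: TB_def mul_V)

lemma inj_TB: "inj_on TB (Y \<times> W)"
proof -
  have *: "k = l" if kl: "k \<in> Y \<times> W" "l \<in> Y \<times> W" "TB k = TB l" and le: "len (snd k) \<le> len (snd l)" for k l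
  proof -
    obtain \<nu> v \<mu> w where kl': "k = (\<nu>, v)" "l = (\<mu>, w)" by (cases k, cases l)
    have "Poly_Mapping.lookup (TB l) (w \<mu>, w) = 1" "Poly_Mapping.lookup (TB k) (w \<mu>, w) = (if v = w \<and> v \<nu> = w \<mu> then 1 else 0)"
      using kl(1,2) le unfolding kl' by (auto simp: lookup_TB)
    then have "(if v = w \<and> v \<nu> = w \<mu> then 1 else 0 :: complex) = 1"
      unfolding kl(3) by metis
    then have "v = w" "w \<nu> = w \<mu>" by (auto split: if_splits)
    moreover have "inj w" using W_bij[of w] kl kl' by (auto simp: bij_is_inj)
    ultimately show ?thesis using kl' by (simp add: inj_eq)
  qed
  show ?thesis
    by (intro inj_onI) (metis * nat_le_linear)
qed

lemma independent_TB: "hv.independent (TB ` (Y \<times> W))"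
proof
  assume "hv.dependent (TB ` (Y \<times> W))"
  then obtain T u v where T: "finite T" "T \<subseteq> TB ` (Y \<times> W)" "(\<Sum>x\<in>T. hscale (u x) x) = 0" "v \<in> T" "u v \<noteq> 0"
    unfolding hv.dependent_explicit by blast
  define F where "F = {k \<in> Y \<times> W. TB k \<in> T}"
  have inj: "inj_on TB F" using inj_TB by (rule inj_on_subset) (auto simp: F_def)
  have TF: "T = TB ` F" using T(2) by (auto simp: F_def)
  then have finF: "finite F" using T(1) inj by (simp add: finite_image_iff)
  define a where "a k = u (TB k)" for k
  have sum0: "(\<Sum>k\<in>F. hscale (a k) (TB k)) = 0"
    using T(3) unfolding TF by (simp add: sum.reindex[OF inj] a_def)
  define G where "G = {k \<in> F. a k \<noteq> 0}"
  have "finite G" "G \<noteq> {}"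
    using finF T(4,5) TF by (auto simp: G_def a_def)
  \<comment> \<open>A term of maximal length among those with nonzero coefficient: the coordinate at
    its leading position isolates that coefficient.\<close>
  then obtain l where l: "l \<in> G" and max: "\<And>k. k \<in> G \<Longrightarrow> len (snd k) \<le> len (snd l)"
    using Max_in[of "(len \<circ> snd) ` G"] Max_ge[of "(len \<circ> snd) ` G"] by fastforce
  obtain \<mu> w where lw: "l = (\<mu>, w)" by (cases l)
  have "inj w" using W_bij[of w] l lw by (auto simp: bij_is_inj G_def F_def)
  have "0 = Poly_Mapping.lookup (\<Sum>k\<in>F. hscale (a k) (TB k)) (w \<mu>, w)"
    by (simp add: sum0)
  also have "\<dots> = (\<Sum>k\<in>F. a k * Poly_Mapping.lookup (TB k) (w \<mu>, w))"
    by (simp add: lookup_sum)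
  also have "\<dots> = (\<Sum>k\<in>F. if k = l then a l else 0)"
  proof (rule sum.cong[OF refl])
    fix k assume k: "k \<in> F"
    obtain \<nu> v where kv: "k = (\<nu>, v)" by (cases k)
    show "a k * Poly_Mapping.lookup (TB k) (w \<mu>, w) = (if k = l then a l else 0)"
    proof (cases "k \<in> G")
      case True
      then have "len v \<le> len w" "\<nu> \<in> Y" "v \<in> W"
        using max[of k] k by (auto simp: kv lw F_def)
      then show ?thesis
        using \<open>inj w\<close> by (auto simp: kv lw lookup_TB inj_eq)
    qed (use k l in \<open>auto simp: G_def\<close>)
  qed
  also have "\<dots> = a l"
    using finF l by (simp add: G_def)
  finally show False using l by (simp add: G_def)
qed

lemma ZH_in_span_TB: "w \<in> W \<Longrightarrow> \<mu> \<in> Y \<Longrightarrow> ZH \<mu> w \<in> hv.span (TB ` (Y \<times> W))"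
proof (induction "len w" arbitrary: w \<mu> rule: less_induct)
  case less
  \<comment> \<open>Chosen so that the leading term of \<open>TB (?\<nu>, w)\<close> is
    \<open>ZH \<mu> w\<close>; the remainder is shorter and falls under the induction
    hypothesis.\<close>
  let ?\<nu> = "inv_into UNIV w \<mu>"
  have \<nu>: "?\<nu> \<in> Y" "w ?\<nu> = \<mu>" using less by (auto simp: W_inv_Y)
  have "f \<in> hv.span (TB ` (Y \<times> W))" if "f \<in> shorter (len w)" for f
    using that
  proof (induction rule: hsp_induct)
    case (ZH \<kappa> v)
    then show ?case using less.hyps[of v \<kappa>] by auto
  qed (auto intro: hv.span_add hv.span_scale hv.span_zero)
  then have "TB (?\<nu>, w) - ZH (w ?\<nu>) w \<in> hv.span (TB ` (Y \<times> W))"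
    using Hb_Zb_leading[OF less.prems(1) \<nu>(1)] by (simp add: TB_def)
  moreover have "TB (?\<nu>, w) \<in> hv.span (TB ` (Y \<times> W))"
    using \<nu> less.prems by (intro hv.span_base) auto
  ultimately have "TB (?\<nu>, w) - (TB (?\<nu>, w) - ZH (w ?\<nu>) w) \<in> hv.span (TB ` (Y \<times> W))"
    by (rule hv.span_diff[rotated])
  then have "ZH (w ?\<nu>) w \<in> hv.span (TB ` (Y \<times> W))" by simp
  then show ?case unfolding \<nu>(2) .
qed

lemma span_TB: "hv.span (TB ` (Y \<times> W)) = V"
proof
  show "hv.span (TB ` (Y \<times> W)) \<subseteq> V"
    by (rule hv.span_minimal) (auto intro: TB_V subspace_hsp)
  show "V \<subseteq> hv.span (TB ` (Y \<times> W))"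
    unfolding hsp_span by (rule hv.span_minimal) (auto intro: ZH_in_span_TB)
qed

lemma V_induct [consumes 1, case_names zero add scale TB]:
  assumes "f \<in> V" "P 0" "\<And>a b. P a \<Longrightarrow> P b \<Longrightarrow> P (a + b)" "\<And>c a. P a \<Longrightarrow> P (hscale c a)"
    and "\<And>\<nu> w. \<nu> \<in> Y \<Longrightarrow> w \<in> W \<Longrightarrow> P (Hb w \<star> Zb \<nu>)"
  shows "P f"
proof -
  have "hv.subspace (Collect P)"
    by (rule hv.subspaceI) (use assms in auto)
  moreover have "TB ` (Y \<times> W) \<subseteq> Collect P"
    using assms(5) by (auto simp: TB_def)
  ultimately show ?thesis
    using hv.span_minimal assms(1) unfolding span_TB[symmetric] by blast
qed

end

locale principal_series = hecke_algebra S q m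
  for S :: "('i, 'v::real_vector) root_system" and q :: nat and m :: "'v hecke \<Rightarrow> 'v hecke \<Rightarrow> 'v hecke" +
  fixes \<tau> :: "'v \<Rightarrow> complex"
  assumes \<tau>: "torus_character S \<tau>"
begin

text \<open>The module is V / J, and \<open>pr\<close> is the projection of V onto HW along J.\<close>

definition J :: "'v hecke set" where
  "J = hv.span {x \<star> a - hscale (char_ext \<tau> a) x | x a. x \<in> V \<and> a \<in> A}"

definition pr :: "'v hecke \<Rightarrow> 'v hecke" where
  "pr = hp.construct (TB ` (Y \<times> W))
     (\<lambda>x. case inv_into (Y \<times> W) TB x of (\<nu>, w) \<Rightarrow> hscale (\<tau> \<nu>) (Hb w))"

lemma pr_linear: "hlinear pr"
  unfolding pr_def by (rule hp.linear_construct[OF independent_TB])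

lemma pr_TB: "\<nu> \<in> Y \<Longrightarrow> w \<in> W \<Longrightarrow> pr (Hb w \<star> Zb \<nu>) = hscale (\<tau> \<nu>) (Hb w)"
proof -
  assume "\<nu> \<in> Y" "w \<in> W"
  then have k: "(\<nu>, w) \<in> Y \<times> W" by simp
  have "pr (TB (\<nu>, w)) = hscale (\<tau> \<nu>) (Hb w)"
    unfolding pr_def
    by (subst hp.construct_basis[OF independent_TB imageI[OF k]]) (simp add: inv_into_f_f[OF inj_TB k])
  then show "pr (Hb w \<star> Zb \<nu>) = hscale (\<tau> \<nu>) (Hb w)"
    by (simp add: TB_def)
qed

lemmas pr_lin = hp.linear_add[OF pr_linear] hp.linear_diff[OF pr_linear] hp.linear_scale[OF pr_linear]
  hp.linear_0[OF pr_linear]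

lemma pr_HW: "h \<in> HW \<Longrightarrow> pr h = h"
proof (induction rule: hsp_induct)
  case (ZH \<nu> w)
  then have "pr (Hb w \<star> Zb 0) = hscale (\<tau> 0) (Hb w)"
    by (intro pr_TB) (auto simp: Y_lattice_closed)
  with ZH show ?case by (simp add: Hb_one char_one[OF \<tau>])
qed (auto simp: pr_lin)

text \<open>The projection turns right multiplication by C[Y] into scalars, and therefore vanishes
  on the generators of J.\<close>

lemma pr_mul:
  assumes "x \<in> V" "a \<in> A"
  shows "pr (x \<star> a) = hscale (char_ext \<tau> a) (pr x)"
  using assms(1)
proof (induction rule: V_induct)
  case (TB \<nu> w)
  from assms(2) show ?case
  proof (induction rule: hsp_induct)
    case (ZH \<mu> v)
    then have "pr (Hb w \<star> Zb \<nu> \<star> Zb \<mu>) = hscale (\<tau> \<mu>) (pr (Hb w \<star> Zb \<nu>))"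
      using TB \<tau> by (simp add: mul_assoc Zb_Zb pr_TB Y_lattice_closed torus_character_def mult.commute)
    moreover have "v = id" using ZH by auto
    ultimately have "pr (Hb w \<star> Zb \<nu> \<star> ZH \<mu> v) = hscale (char_ext \<tau> (ZH \<mu> v)) (pr (Hb w \<star> Zb \<nu>))"
      by simp
    then show ?case .
  qed (auto simp: mul_lin pr_lin char_ext_add char_ext_scale hv.scale_left_distrib)
qed (auto simp: mul_lin pr_lin hv.scale_right_distrib hv.scale_left_commute)

lemma pr_J: "j \<in> J \<Longrightarrow> pr j = 0"
proof -
  have "J \<subseteq> {j. pr j = 0}"
    unfolding J_def
    by (rule hv.span_minimal) (auto simp: pr_mul pr_lin intro!: hv.subspaceI)
  then show "j \<in> J \<Longrightarrow> pr j = 0" by blast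
qed

lemma J_subspace: "hv.subspace J"
  by (simp add: J_def)

lemmas J_add = hv.subspace_add[OF J_subspace]
  and J_diff = hv.subspace_diff[OF J_subspace]
  and J_scale = hv.subspace_scale[OF J_subspace]
  and J_0 = hv.subspace_0[OF J_subspace]

lemma J_gen: "x \<in> V \<Longrightarrow> a \<in> A \<Longrightarrow> x \<star> a - hscale (char_ext \<tau> a) x \<in> J"
  unfolding J_def by (rule hv.span_base) blast

lemma J_V: "J \<subseteq> V"
  unfolding J_def
  by (rule hv.span_minimal) (auto intro!: hsp_diff hsp_scale mul_V subspace_hsp)

text \<open>A left factor y turns the generator for x and a into the generator for
  \<open>y \<star> x\<close> and a.\<close>

lemma J_left: "j \<in> J \<Longrightarrow> y \<star> j \<in> J"
proof -
  have "J \<subseteq> {j. y \<star> j \<in> J}"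
    unfolding J_def
  proof (rule hv.span_minimal)
    show "hv.subspace {j. y \<star> j \<in> hv.span {x \<star> a - hscale (char_ext \<tau> a) x | x a. x \<in> V \<and> a \<in> A}}"
      unfolding J_def[symmetric] by (auto intro!: hv.subspaceI simp: mul_lin J_add J_scale J_0)
    show "{x \<star> a - hscale (char_ext \<tau> a) x | x a. x \<in> V \<and> a \<in> A}
        \<subseteq> {j. y \<star> j \<in> hv.span {x \<star> a - hscale (char_ext \<tau> a) x | x a. x \<in> V \<and> a \<in> A}}"
      unfolding J_def[symmetric] using J_gen[OF mul_V]
      by (auto simp: mul_lin mul_assoc[symmetric])
  qed
  then show "j \<in> J \<Longrightarrow> y \<star> j \<in> J" by blast
qed

text \<open>The projection is the identity on HW and zero on J. So HW embeds in V / J, and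
  congruences modulo J between elements of HW are equalities.\<close>

lemma J_HW: "h \<in> HW \<Longrightarrow> h \<in> J \<Longrightarrow> h = 0"
  using pr_HW pr_J by metis

section \<open>Comparison of the tensor product with V / J\<close>

definition tens_eval :: "('v hecke \<times> complex \<Rightarrow>\<^sub>0 int) \<Rightarrow> 'v hecke" where
  "tens_eval c = (\<Sum>k\<in>Poly_Mapping.keys c. hscale (of_int (Poly_Mapping.lookup c k) * snd k) (fst k))"

lemma tens_eval_superset:
  assumes "finite B" "Poly_Mapping.keys c \<subseteq> B"
  shows "tens_eval c = (\<Sum>k\<in>B. hscale (of_int (Poly_Mapping.lookup c k) * snd k) (fst k))"
  unfolding tens_eval_def using assms by (intro sum.mono_neutral_left) (auto simp: in_keys_iff)

lemma tens_eval_add: "tens_eval (c + d) = tens_eval c + tens_eval d"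
proof -
  let ?B = "Poly_Mapping.keys c \<union> Poly_Mapping.keys d"
  show ?thesis
    using keys_add[of c d]
    by (simp add: tens_eval_superset[of ?B] lookup_add sum.distrib[symmetric] hv.scale_left_distrib[symmetric]
        distrib_right)
qed

lemma tens_eval_0 [simp]: "tens_eval 0 = 0"
  by (simp add: tens_eval_def)

lemma tens_eval_minus: "tens_eval (- c) = - tens_eval c"
  using tens_eval_add[of c "- c"] by (simp add: eq_neg_iff_add_eq_0 add.commute)

lemma tens_eval_diff: "tens_eval (c - d) = tens_eval c - tens_eval d"
  using tens_eval_add[of c "- d"] by (simp add: tens_eval_minus)

lemma tens_eval_of [simp]: "tens_eval (frag_of (x, z)) = hscale z x"
  by (simp add: tens_eval_def)

text \<open>A left ideal L between J and V gives a stable subgroup of the tensor product, namely the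
  classes of formal sums whose value under x \<otimes> z \<mapsto> zx lies in L;
  \<open>tens_eval\<close> is this evaluation on the free abelian group.\<close>

lemma irreducible_left_ideal:
  assumes irr: "irreducible_module (hecke_space S) (I_module S m \<tau>) (I_action S m \<tau>)"
    and L: "hv.subspace L" "\<And>y x. y \<in> V \<Longrightarrow> x \<in> L \<Longrightarrow> y \<star> x \<in> L" "J \<subseteq> L" "L \<subseteq> V"
  shows "L = J \<or> L = V"
proof -
  define F where "F = free_Abelian_group (V \<times> (UNIV :: complex set))"
  define R where "R = tensor_relations V A (UNIV :: complex set) m (\<lambda>\<theta> z. char_ext \<tau> \<theta> * z)"
  define N where "N = tensor_null V A (UNIV :: complex set) m (\<lambda>\<theta> z. char_ext \<tau> \<theta> * z)"
  have N: "N = generate F R"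
    by (simp add: N_def R_def F_def tensor_null_def)
  interpret F: comm_group F
    unfolding F_def by (rule abelian_free_Abelian_group)
  have Fcar: "c \<in> carrier F \<longleftrightarrow> Poly_Mapping.keys c \<subseteq> V \<times> UNIV" for c
    by (simp add: F_def)
  have Fop [simp]: "c \<otimes>\<^bsub>F\<^esub> d = c + d" "\<one>\<^bsub>F\<^esub> = 0" for c d
    by (simp_all add: F_def)
  have Finv: "inv\<^bsub>F\<^esub> c = - c" if "c \<in> carrier F" for c
    using that by (simp add: F_def)
  have Fof: "frag_of (x, z) \<in> carrier F" if "x \<in> V" for x z
    using that by (simp add: F_def)
  have mV: "m x a = x \<star> a" if "x \<in> V" "a \<in> V" for x a
    using that by (simp add: mul_eq)
  have Fdiff: "c - d \<in> carrier F" if "c \<in> carrier F" "d \<in> carrier F" for c d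
    using F.m_closed[OF that(1) F.inv_closed[OF that(2)]] by (simp add: Finv that)
  have R_car: "R \<subseteq> carrier F"
    unfolding R_def tensor_relations_def
    by (intro Un_least subsetI; clarsimp; intro Fdiff Fof; (simp add: hsp_add mV mul_V subsetD[OF A_V])?)
  have N_sub: "subgroup N F"
    unfolding N by (rule F.generate_is_subgroup[OF R_car])
  then have N_normal: "N \<lhd> F"
    by (rule F.subgroup_imp_normal)
  \<comment> \<open>The additivity relations evaluate to 0, and the balancing relation evaluates to
    a multiple of a generator of J.\<close>
  have evN: "tens_eval c \<in> J" if "c \<in> N" for c
    using that unfolding N
  proof (induction rule: generate.induct)
    case (incl h)
    have "tens_eval h \<in> J" if h: "h = frag_of (m x a, z) - frag_of (x, char_ext \<tau> a * z)" "x \<in> V" "a \<in> A" for x a z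
    proof -
      have "tens_eval h = hscale z (x \<star> a - hscale (char_ext \<tau> a) x)"
        using h A_V by (simp add: tens_eval_diff mV subsetD hv.scale_right_diff_distrib mult.commute)
      then show ?thesis using J_gen h by (simp add: J_scale)
    qed
    with incl show ?case
      by (auto simp: R_def tensor_relations_def tens_eval_diff hv.scale_left_distrib hv.scale_right_distrib J_0)
  next
    case (inv h)
    have "tens_eval h \<in> J" if h: "h = frag_of (m x a, z) - frag_of (x, char_ext \<tau> a * z)" "x \<in> V" "a \<in> A" for x a z
    proof -
      have "tens_eval h = hscale z (x \<star> a - hscale (char_ext \<tau> a) x)"
        using h A_V by (simp add: tens_eval_diff mV subsetD hv.scale_right_diff_distrib mult.commute)
      then show ?thesis using J_gen h by (simp add: J_scale)
    qed
    with inv have "tens_eval h \<in> J"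
      by (auto simp: R_def tensor_relations_def tens_eval_diff hv.scale_left_distrib hv.scale_right_distrib J_0)
    then show ?case
      using Finv inv R_car hv.subspace_neg[OF J_subspace] by (auto simp: tens_eval_minus)
  qed (auto simp: tens_eval_add J_add J_0)
  define K where "K = {c \<in> carrier F. tens_eval c \<in> L}"
  have K_sub: "subgroup K F"
  proof (rule F.subgroupI)
    show "K \<subseteq> carrier F" by (auto simp: K_def)
    have "0 \<in> K" using F.one_closed hv.subspace_0[OF L(1)] by (simp add: K_def)
    then show "K \<noteq> {}" by blast
    show "inv\<^bsub>F\<^esub> a \<in> K" if "a \<in> K" for a
      using that F.inv_closed[of a] hv.subspace_neg[OF L(1)] by (simp add: K_def Finv tens_eval_minus)
    show "a \<otimes>\<^bsub>F\<^esub> b \<in> K" if "a \<in> K" "b \<in> K" for a b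
      using that F.m_closed[of a b] hv.subspace_add[OF L(1)] by (simp add: K_def tens_eval_add)
  qed
  define M where "M = F Mod N"
  have M: "I_module S m \<tau> = M"
    by (simp add: I_module_def tensor_product_def M_def F_def N_def V_eq A_eq)
  have Mgroup: "group M"
    unfolding M_def by (rule normal.factorgroup_is_group[OF N_normal])
  have hom: "group_hom F M (r_coset F N)"
    unfolding M_def using normal.r_coset_hom_Mod[OF N_normal] Mgroup
    by (intro group_hom.intro group_hom_axioms.intro) (auto simp: M_def F.is_group)
  define P where "P = r_coset F N ` K"
  have P_sub: "subgroup P M"
    unfolding P_def by (rule group_hom.subgroup_img_is_subgroup[OF hom K_sub])
  have coset: "N #>\<^bsub>F\<^esub> c = {n + c | n. n \<in> N}" for c
    by (auto simp: r_coset_def)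
  have "0 \<in> N" using subgroup.one_closed[OF N_sub] by simp
  \<comment> \<open>Two representatives of a class differ by an element of N, whose value lies in J
    and hence in L, so the choice of representative is immaterial.\<close>
  have P_D: "tens_eval c \<in> L" if c: "N #>\<^bsub>F\<^esub> c \<in> P" for c
  proof -
    obtain d where d: "d \<in> K" "N #>\<^bsub>F\<^esub> c = N #>\<^bsub>F\<^esub> d"
      using c unfolding P_def by blast
    have "c \<in> N #>\<^bsub>F\<^esub> c"
      unfolding coset using \<open>0 \<in> N\<close> by (intro CollectI exI[of _ 0]) simp
    then have "c \<in> N #>\<^bsub>F\<^esub> d" unfolding d(2) .
    then have "c \<in> {n + d | n. n \<in> N}" unfolding coset .
    then obtain n where "n \<in> N" "c = n + d" by auto
    moreover have "tens_eval n \<in> L" using evN[OF \<open>n \<in> N\<close>] L(3) by blast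
    ultimately show ?thesis
      using d(1) hv.subspace_add[OF L(1)] unfolding K_def by (simp add: tens_eval_add)
  qed
  have act: "I_action S m \<tau> h x \<in> P" if h: "h \<in> V" and x: "x \<in> P" for h x
  proof -
    obtain c where c: "c \<in> K" "x = N #>\<^bsub>F\<^esub> c"
      using x unfolding P_def by blast
    define g where "g = (\<lambda>(x :: 'v hecke, z :: complex). frag_of (m h x, z))"
    let ?e = "frag_extend g"
    have e_car: "?e d \<in> carrier F" if "d \<in> carrier F" for d
    proof -
      have "Poly_Mapping.keys (?e d) \<subseteq> (\<Union>k\<in>Poly_Mapping.keys d. Poly_Mapping.keys (g k))"
        by (rule keys_frag_extend)
      also have "\<dots> \<subseteq> V \<times> UNIV"
        using that h by (auto simp: g_def Fcar mV mul_V split: prod.splits)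
      finally show ?thesis by (simp add: Fcar)
    qed
    have e_R: "?e d \<in> R" if "d \<in> R" for d
    proof -
      have g: "g (x, z) = frag_of (h \<star> x, z)" if "x \<in> V" for x z
        using that h by (simp add: g_def mV)
      from \<open>d \<in> R\<close> consider
        x x' z where "d = frag_of (x + x', z) - frag_of (x, z) - frag_of (x', z)" "x \<in> V" "x' \<in> V"
        | x z z' where "d = frag_of (x, z + z') - frag_of (x, z) - frag_of (x, z')" "x \<in> V"
        | x a z where "d = frag_of (m x a, z) - frag_of (x, char_ext \<tau> a * z)" "x \<in> V" "a \<in> A"
        unfolding R_def tensor_relations_def by blast
      then show ?thesis
      proof cases
        case 1
        then have "?e d = frag_of (h \<star> x + h \<star> x', z) - frag_of (h \<star> x, z) - frag_of (h \<star> x', z)"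
          by (simp add: frag_extend_diff g hsp_add mul_add_right)
        then show ?thesis unfolding R_def tensor_relations_def using mul_V by blast
      next
        case 2
        then have "?e d = frag_of (h \<star> x, z + z') - frag_of (h \<star> x, z) - frag_of (h \<star> x, z')"
          by (simp add: frag_extend_diff g)
        then show ?thesis unfolding R_def tensor_relations_def using mul_V by blast
      next
        case 3
        then have "?e d = frag_of (m (h \<star> x) a, z) - frag_of (h \<star> x, char_ext \<tau> a * z)"
          using A_V by (simp add: frag_extend_diff g mV mul_V mul_assoc subsetD)
        then show ?thesis unfolding R_def tensor_relations_def using mul_V 3(3) by blast
      qed
    qed
    have e_N: "?e d \<in> N" if "d \<in> N" for d
      using that unfolding N
    proof (induction rule: generate.induct)
      case (inv d)
      then have "?e (inv\<^bsub>F\<^esub> d) = inv\<^bsub>F\<^esub> (?e d)"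
        using R_car e_R by (simp add: Finv subsetD frag_extend_minus)
      then show ?case using inv e_R by (auto intro: generate.inv)
    qed (auto simp: frag_extend_add intro: generate.incl e_R generate.eng[of _ F, simplified]
        generate.one[of F, simplified])
    have "tens_eval (?e d) = h \<star> tens_eval d" if "d \<in> carrier F" for d
    proof -
      have "Poly_Mapping.keys d \<subseteq> V \<times> UNIV" using that by (simp add: Fcar)
      then show ?thesis
        by (induction d rule: frag_induction)
          (auto simp: frag_extend_diff tens_eval_diff mul_lin g_def mV h)
    qed
    then have eK: "?e c \<in> K"
      using c h L(2) e_car by (auto simp: K_def)
    have "I_action S m \<tau> h x = N <#>\<^bsub>F\<^esub> (?e ` x)"
      by (simp add: I_action_def tensor_map_left_def V_eq A_eq N_def F_def g_def)
    \<comment> \<open>The image of the coset falls into the single coset of \<open>?e c\<close>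
      because \<open>?e\<close> preserves N; taking the element 0 of N gives the converse
      inclusion.\<close>
    also have "\<dots> = N #>\<^bsub>F\<^esub> ?e c"
    proof -
      have "n + ?e (n' + c) = (n + ?e n') + ?e c" for n n'
        by (simp add: frag_extend_add add.assoc)
      moreover have "n + ?e n' \<in> N" if "n \<in> N" "n' \<in> N" for n n'
        using subgroup.m_closed[OF N_sub that(1) e_N[OF that(2)]] by simp
      moreover have "n = n + ?e 0" for n by simp
      ultimately show ?thesis
        unfolding c coset set_mult_def using \<open>0 \<in> N\<close> by (auto; metis)
    qed
    finally show ?thesis using eK by (simp add: P_def)
  qed
  have "P = {\<one>\<^bsub>M\<^esub>} \<or> P = carrier M"
    using irr P_sub act unfolding irreducible_module_def M V_eq by blast
  then show ?thesis
  proof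
    assume P1: "P = {\<one>\<^bsub>M\<^esub>}"
    have "x \<in> J" if "x \<in> L" for x
    proof -
      have "frag_of (x, 1) \<in> K"
        using that L(4) Fof by (auto simp: K_def)
      then have "N #>\<^bsub>F\<^esub> frag_of (x, 1) = N"
        using P1 by (auto simp: P_def M_def)
      then have "frag_of (x, 1) \<in> N"
        using \<open>0 \<in> N\<close> unfolding coset by (metis (mono_tags, lifting) CollectI add_0)
      then show ?thesis using evN[of "frag_of (x, 1)"] by simp
    qed
    with L(3) show ?thesis by blast
  next
    assume P2: "P = carrier M"
    have "x \<in> L" if "x \<in> V" for x
    proof -
      have "N #>\<^bsub>F\<^esub> frag_of (x, 1) \<in> P"
        unfolding P2 M_def carrier_FactGroup using Fof[OF that] by blast
      then show ?thesis using P_D[of "frag_of (x, 1)"] by simp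
    qed
    with L(4) show ?thesis by blast
  qed
qed

end

section \<open>Weight vectors and intertwiners\<close>

context root_data
begin

text \<open>The character \<nu> \<mapsto> \<chi> (w \<nu>) is
  \<open>w\<^sup>-\<^sup>1.\<chi>\<close>. Weights are kept in this form, so each further
  intertwiner composes a reflection on the right of w.\<close>

lemma char_comp_W: "torus_character S \<chi> \<Longrightarrow> w \<in> W \<Longrightarrow> torus_character S (\<lambda>\<nu>. \<chi> (w \<nu>))"
  unfolding torus_character_def by (auto simp: W_Y linear_add[OF W_linear])

lemma char_add: "torus_character S \<chi> \<Longrightarrow> \<nu> \<in> Y \<Longrightarrow> \<mu> \<in> Y \<Longrightarrow> \<chi> (\<nu> + \<mu>) = \<chi> \<nu> * \<chi> \<mu>"
  by (simp add: torus_character_def)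

lemma char_scale:
  assumes "torus_character S \<chi>" "\<nu> \<in> Y" "\<chi> \<nu> = 1"
  shows "\<chi> (of_int k *\<^sub>R \<nu>) = 1"
proof (induction k rule: int_induct[of _ 0])
  case base
  have "\<chi> 0 * \<chi> 0 = \<chi> 0" "\<chi> 0 \<noteq> 0"
    using assms Y_lattice_closed(1) unfolding torus_character_def by (metis add_0)+
  then show ?case by simp
next
  case (step1 i)
  have "\<chi> (of_int i *\<^sub>R \<nu> + \<nu>) = 1"
    using assms step1 Y_scale[OF assms(2)] unfolding torus_character_def by simp
  then show ?case by (simp add: scaleR_left_distrib)
next
  case (step2 i)
  have "\<chi> (of_int (i - 1) *\<^sub>R \<nu> + \<nu>) = \<chi> (of_int (i - 1) *\<^sub>R \<nu>) * 1"
    using assms Y_scale[OF assms(2), of "i - 1"] unfolding torus_character_def by simp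
  then show ?case using step2 by (simp add: scaleR_left_diff_distrib)
qed

text \<open>The two arguments differ by an integral multiple of the coroot, on which \<chi> is
  1.\<close>

lemma char_rf:
  assumes "torus_character S \<chi>" "i \<in> I" "\<chi> (cr i) = 1" "\<nu> \<in> Y"
  shows "\<chi> (rf i \<nu>) = \<chi> \<nu>"
proof -
  obtain k where k: "rt i \<nu> = of_int k" using rt_int assms by blast
  have "\<chi> (\<nu> + of_int (- k) *\<^sub>R cr i) = \<chi> \<nu> * \<chi> (of_int (- k) *\<^sub>R cr i)"
    by (rule char_add[OF assms(1,4) Y_scale[OF cr_Y[OF assms(2)]]])
  also have "\<chi> (of_int (- k) *\<^sub>R cr i) = 1"
    by (rule char_scale[OF assms(1) cr_Y[OF assms(2)] assms(3)])
  finally show ?thesis using k by (simp add: simple_refl_def)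
qed

lemma len_comp: "v \<in> W \<Longrightarrow> w \<in> W \<Longrightarrow> len (v \<circ> w) \<le> len v + len w"
proof -
  assume "v \<in> W" "w \<in> W"
  obtain vs where vs: "set vs \<subseteq> I" "v = word vs" "length vs = len v"
    using reduced_word[OF \<open>v \<in> W\<close>] by blast
  obtain ws where ws: "set ws \<subseteq> I" "w = word ws" "length ws = len w"
    using reduced_word[OF \<open>w \<in> W\<close>] by blast
  show "len (v \<circ> w) \<le> len v + len w"
    using len_word[of "vs @ ws"] vs ws by (simp add: word_append)
qed

lemma word_W: "set ws \<subseteq> I \<Longrightarrow> word ws \<in> W"
  using W_words by auto

lemma len_rev_word: "set ws \<subseteq> I \<Longrightarrow> len (word (rev ws)) = len (word ws)"
proof -
  have *: "len (word (rev ws)) \<le> len (word ws)" if ws: "set ws \<subseteq> I" for ws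
  proof -
    obtain vs where vs: "set vs \<subseteq> I" "word ws = word vs" "length vs = len (word ws)"
      using reduced_word[OF word_W[OF ws]] by blast
    have "word (rev ws) = word (rev vs)"
      using inv_word[OF ws] inv_word[OF vs(1)] vs(2) by simp
    then show ?thesis using len_word[of "rev vs"] vs by simp
  qed
  assume "set ws \<subseteq> I"
  then show ?thesis using *[of ws] *[of "rev ws"] by simp
qed

lemma reduced_take:
  assumes "set ws \<subseteq> I" "len (word ws) = length ws" "k \<le> length ws"
  shows "len (word (take k ws)) = k"
proof -
  have sub: "set (take k ws) \<subseteq> I" "set (drop k ws) \<subseteq> I"
    using assms(1) set_take_subset set_drop_subset by fast+
  have "word ws = word (take k ws) \<circ> word (drop k ws)"
    by (metis append_take_drop_id word_append)
  then have "length ws \<le> len (word (take k ws)) + (length ws - k)"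
    using len_comp[OF word_W[OF sub(1)] word_W[OF sub(2)]] len_word[OF sub(2)] assms(2) by simp
  then show ?thesis using len_word[OF sub(1)] assms(3) by simp
qed

end

section \<open>Coefficients and inverses of the intertwiners\<close>

context hecke_algebra
begin

lemma HW_V': "h \<in> HW \<Longrightarrow> h \<in> V"
  using HW_V by blast

text \<open>Value of the Bernstein--Lusztig coefficient at a character that takes the value z on the
  coroot. At z = 1 the formula degenerates to 0; the intertwining steps exclude that value.\<close>

definition Qc :: "complex \<Rightarrow> complex" where
  "Qc z = hc / (1 - inverse z)"

lemma hc_sq: "hc * hc = of_nat q - 2 + 1 / of_nat q"
proof -
  have "sqrt (real q) * sqrt (real q) = real q" "sqrt (real q) \<noteq> 0" using q_ge_2 by auto
  then have "(sqrt (real q) - inverse (sqrt (real q)))\<^sup>2 = real q - 2 + 1 / real q"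
    by (simp add: power2_eq_square algebra_simps inverse_eq_divide)
  then have "complex_of_real ((sqrt (real q) - inverse (sqrt (real q)))\<^sup>2) = of_nat q - 2 + 1 / of_nat q"
    by simp
  then show ?thesis by (simp add: hc_def power2_eq_square)
qed

text \<open>The left-hand side is the scalar in \<open>Es_Es\<close> for a = \<open>Qc z\<close> and
  b = \<open>hc - Qc z\<close>. It vanishes exactly at q and 1/q, where the intertwiner stops being
  invertible.\<close>

lemma Qc_discriminant:
  assumes "z \<noteq> 0" "z \<noteq> 1"
  shows "1 + Qc z * (hc - Qc z) = (z - of_nat q) * (z - 1 / of_nat q) / (z - 1)\<^sup>2"
proof -
  have z: "z - 1 \<noteq> 0" using assms by simp
  have Q: "Qc z = hc * z / (z - 1)"
    using assms by (simp add: Qc_def field_simps)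
  then have Q': "hc - Qc z = - hc / (z - 1)"
    using z by (simp add: field_simps)
  have "1 + (hc * z / u) * (- hc / u) = (u\<^sup>2 - (hc * hc) * z) / u\<^sup>2" if "u \<noteq> 0" for u
    using that by (simp add: field_simps power2_eq_square)
  from this[OF z] have "1 + Qc z * (hc - Qc z) = ((z - 1)\<^sup>2 - (hc * hc) * z) / (z - 1)\<^sup>2"
    unfolding Q' unfolding Q .
  also have "(z - 1)\<^sup>2 - (hc * hc) * z = (z - of_nat q) * (z - 1 / of_nat q)"
    unfolding hc_sq using q_ge_2 by (simp add: field_simps power2_eq_square)
  finally show ?thesis .
qed

definition Es :: "'i \<Rightarrow> complex \<Rightarrow> 'v hecke" where
  "Es i a = Hb (rf i) - hscale a (Zb 0)"

lemma Es_HW: "i \<in> I \<Longrightarrow> Es i a \<in> HW"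
  unfolding Es_def by (intro hsp_diff hsp_scale one_HW ZH_in_hsp) (simp add: W_rf)

lemma Es_mul: "x \<in> V \<Longrightarrow> Es i a \<star> x = Hb (rf i) \<star> x - hscale a x"
  by (simp add: Es_def mul_lin one_left)

text \<open>By the quadratic relation for \<open>Hb (rf i)\<close>, the terms linear in it cancel
  when a + b = \<open>hc\<close>.\<close>

lemma Es_Es: "i \<in> I \<Longrightarrow> a + b = hc \<Longrightarrow> Es i a \<star> Es i b = hscale (1 + a * b) (Zb 0)"
proof -
  assume i: "i \<in> I" and ab: "a + b = hc"
  have V: "Hb (rf i) \<in> V" using i by (simp add: ZH_V Y_lattice_closed W_rf)
  have "Es i a \<star> Es i b = hscale (a + b) (Hb (rf i)) + Zb 0 - hscale b (Hb (rf i)) - hscale a (Hb (rf i))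
      + hscale (a * b) (Zb 0)"
    unfolding Es_def using i V
    by (simp add: mul_lin Hb_rf_sq one_left one_right one_V ab algebra_simps)
  also have "\<dots> = hscale (1 + a * b) (Zb 0)"
    by (simp add: hv.scale_left_distrib algebra_simps)
  finally show ?thesis .
qed

lemma Es_nonzero: "i \<in> I \<Longrightarrow> Es i a \<noteq> 0"
proof
  assume i: "i \<in> I" and 0: "Es i a = 0"
  have "rf i \<noteq> id" using len_rf[OF i] by auto
  then have "Poly_Mapping.lookup (Es i a) (0, rf i) = 1"
    by (simp add: Es_def lookup_minus lookup_ZH)
  with 0 show False by simp
qed

end

context principal_series
begin

text \<open>The eigenvector condition concerns the class of x in V / J, while x stays a
  representative in V; zero is allowed.\<close>

definition wt :: "('v \<Rightarrow> complex) \<Rightarrow> 'v hecke \<Rightarrow> bool" where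
  "wt \<chi> x \<longleftrightarrow> x \<in> V \<and> (\<forall>\<nu>\<in>Y. Zb \<nu> \<star> x - hscale (\<chi> \<nu>) x \<in> J)"

lemma wt_cong: "wt \<chi> x \<Longrightarrow> (\<And>\<nu>. \<nu> \<in> Y \<Longrightarrow> \<chi> \<nu> = \<chi>' \<nu>) \<Longrightarrow> wt \<chi>' x"
  by (simp add: wt_def)

lemma wt_A: "wt \<chi> x \<Longrightarrow> \<theta> \<in> A \<Longrightarrow> \<theta> \<star> x - hscale (char_ext \<chi> \<theta>) x \<in> J"
proof (rotate_tac, induction rule: hsp_induct)
  case (ZH \<nu> w)
  then have "Zb \<nu> \<star> x - hscale (char_ext \<chi> (Zb \<nu>)) x \<in> J" by (auto simp: wt_def)
  moreover have "w = id" using ZH by auto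
  ultimately show ?case by blast
next
  case (add a b)
  have "(a + b) \<star> x - hscale (char_ext \<chi> (a + b)) x
      = (a \<star> x - hscale (char_ext \<chi> a) x) + (b \<star> x - hscale (char_ext \<chi> b) x)"
    by (simp add: mul_lin char_ext_add hv.scale_left_distrib)
  with add show ?case by (simp only: J_add)
next
  case (scale c a)
  have "hscale c a \<star> x - hscale (char_ext \<chi> (hscale c a)) x = hscale c (a \<star> x - hscale (char_ext \<chi> a) x)"
    by (simp add: mul_lin char_ext_scale hv.scale_right_diff_distrib)
  with scale show ?case by (simp only: J_scale)
qed (simp add: J_0)

text \<open>Next to the unit, \<open>Zb \<nu>\<close> may as well act from the right, where J
  imposes the value \<tau> \<nu>.\<close>

lemma wt_one: "wt \<tau> (Zb 0)"
proof -
  have "Zb \<nu> \<star> Zb 0 - hscale (\<tau> \<nu>) (Zb 0) \<in> J" if "\<nu> \<in> Y" for \<nu>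
  proof -
    have "Zb \<nu> \<in> V" "Zb \<nu> \<in> A" using that by (auto intro: ZH_V ZH_in_hsp W_id)
    then show ?thesis using J_gen[OF one_V, of "Zb \<nu>"] by (simp add: one_left one_right)
  qed
  then show ?thesis by (simp add: wt_def one_V)
qed

lemma wt_diff_scale: "wt \<chi> x \<Longrightarrow> wt \<chi> y \<Longrightarrow> wt \<chi> (x - hscale c y)"
proof -
  assume x: "wt \<chi> x" and y: "wt \<chi> y"
  have "Zb \<nu> \<star> (x - hscale c y) - hscale (\<chi> \<nu>) (x - hscale c y) \<in> J" if "\<nu> \<in> Y" for \<nu>
  proof -
    have "Zb \<nu> \<star> (x - hscale c y) - hscale (\<chi> \<nu>) (x - hscale c y)
        = (Zb \<nu> \<star> x - hscale (\<chi> \<nu>) x) - hscale c (Zb \<nu> \<star> y - hscale (\<chi> \<nu>) y)"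
      by (simp add: mul_lin hv.scale_right_diff_distrib mult.commute)
    with that x y show ?thesis by (simp only: J_diff J_scale wt_def)
  qed
  with x y show ?thesis by (auto simp: wt_def intro: hsp_diff hsp_scale)
qed

text \<open>The intertwining step: \<open>H\<^sub>s - Q\<close> carries weight \<open>\<chi>\<close> to weight \<open>s.\<chi>\<close>, where Q is the value at
  \<open>\<chi>\<close> of the coefficient in the Bernstein--Lusztig relation.\<close>

lemma wt_step:
  assumes \<chi>: "torus_character S \<chi>" and x: "wt \<chi> x" and i: "i \<in> I" and ne: "\<chi> (cr i) \<noteq> 1"
  shows "wt (\<lambda>\<nu>. \<chi> (rf i \<nu>)) (Es i (Qc (\<chi> (cr i))) \<star> x)"
proof -
  define Q where "Q = Qc (\<chi> (cr i))"
  have xV: "x \<in> V" using x by (simp add: wt_def)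
  have "Zb \<nu> \<star> (Es i Q \<star> x) - hscale (\<chi> (rf i \<nu>)) (Es i Q \<star> x) \<in> J" if \<nu>: "\<nu> \<in> Y" for \<nu>
  proof -
    \<comment> \<open>Moving \<open>Hb (rf i)\<close> past \<open>Zb \<mu>\<close> reflects the
      exponent, so \<mu> is the exponent that produces \<open>Zb \<nu>\<close>.\<close>
    define \<mu> where "\<mu> = rf i \<nu>"
    have \<mu>: "\<mu> \<in> Y" "rf i \<mu> = \<nu>" using \<nu> i by (simp_all add: \<mu>_def rf_Y)
    obtain D where D: "D \<in> A" "(Zb 0 - Zb (- cr i)) \<star> D = Zb \<mu> - Zb \<nu>"
      "Hb (rf i) \<star> Zb \<mu> = Zb \<nu> \<star> Hb (rf i) + hscale hc D"
      using BL_relation[OF i \<mu>(1)] \<mu>(2) by metis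
    have "Zb 0 - Zb (- cr i) \<in> A"
      using i by (auto intro!: hsp_diff ZH_in_hsp simp: Y_lattice_closed cr_Y)
    then have "(\<chi> 0 - \<chi> (- cr i)) * char_ext \<chi> D = \<chi> \<mu> - \<chi> \<nu>"
      using char_ext_mul[OF \<chi> _ D(1), of "Zb 0 - Zb (- cr i)"] D(2) by (simp add: char_ext_diff)
    then have "(1 - inverse (\<chi> (cr i))) * char_ext \<chi> D = \<chi> \<mu> - \<chi> \<nu>"
      using char_one[OF \<chi>] char_uminus[OF \<chi> cr_Y[OF i]] by simp
    moreover have "1 - inverse (\<chi> (cr i)) \<noteq> 0" using ne by simp
    \<comment> \<open>Evaluating at \<chi> the equation that defines D and dividing by 1 -
      \<open>inverse (\<chi> (cr i))\<close> produces the coefficient Q.\<close>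
    ultimately have scal: "hc * char_ext \<chi> D = Q * (\<chi> \<mu> - \<chi> \<nu>)"
      unfolding Q_def Qc_def by (metis nonzero_eq_divide_eq mult.assoc times_divide_eq_left)
    have comm: "Hb (rf i) \<star> (Zb \<mu> \<star> x) = Zb \<nu> \<star> (Hb (rf i) \<star> x) + hscale hc (D \<star> x)"
    proof -
      have "Hb (rf i) \<star> (Zb \<mu> \<star> x) = Hb (rf i) \<star> Zb \<mu> \<star> x" by (simp add: mul_assoc)
      then show ?thesis by (simp add: D(3) mul_lin mul_assoc)
    qed
    have sc2: "hscale (hc * char_ext \<chi> D) x = hscale (Q * \<chi> \<mu>) x - hscale (Q * \<chi> \<nu>) x"
      unfolding scal right_diff_distrib by (rule hv.scale_left_diff_distrib)
    \<comment> \<open>With this Q the stray multiples of x cancel, and three elements of J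
      remain.\<close>
    have "Zb \<nu> \<star> (Es i Q \<star> x) - hscale (\<chi> \<mu>) (Es i Q \<star> x)
        = Hb (rf i) \<star> (Zb \<mu> \<star> x - hscale (\<chi> \<mu>) x) - hscale hc (D \<star> x - hscale (char_ext \<chi> D) x)
          - hscale Q (Zb \<nu> \<star> x - hscale (\<chi> \<nu>) x)"
      using comm sc2
      by (simp add: Es_mul[OF xV] mul_lin hv.scale_right_diff_distrib mult.commute)
    moreover have "Zb \<mu> \<star> x - hscale (\<chi> \<mu>) x \<in> J" "Zb \<nu> \<star> x - hscale (\<chi> \<nu>) x \<in> J"
      "D \<star> x - hscale (char_ext \<chi> D) x \<in> J"
      using x \<mu> \<nu> D(1) wt_A by (auto simp: wt_def)
    ultimately show ?thesis
      unfolding \<mu>_def[symmetric] by (simp only: J_diff J_scale J_left)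
  qed
  then show ?thesis by (simp add: wt_def mul_V Q_def)
qed

text \<open>Since C[Y] acts on x by scalars modulo J, the left ideal generated by x and J is
  \<open>HW \<star> x + J\<close>. By irreducibility it contains the unit.\<close>

lemma weight_vector_left_invertible:
  assumes irr: "irreducible_module (hecke_space S) (I_module S m \<tau>) (I_action S m \<tau>)"
    and x: "x \<in> HW" "x \<noteq> 0" "wt \<chi> x"
  obtains k where "k \<in> HW" "k \<star> x = Zb 0"
proof -
  define L where "L = {k \<star> x + j | k j. k \<in> HW \<and> j \<in> J}"
  have L_I: "k \<star> x + j \<in> L" if "k \<in> HW" "j \<in> J" for k j
    using that by (auto simp: L_def)
  have L_sub: "hv.subspace L"
  proof (rule hv.subspaceI)
    show "0 \<in> L" using L_I[OF hsp_0 J_0] by simp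
    show "a + b \<in> L" if ab: "a \<in> L" "b \<in> L" for a b
    proof -
      obtain k j k' j' where kj: "a = k \<star> x + j" "b = k' \<star> x + j'" "k \<in> HW" "k' \<in> HW" "j \<in> J" "j' \<in> J"
        using ab by (auto simp: L_def)
      have "a + b = (k + k') \<star> x + (j + j')" using kj by (simp add: mul_lin)
      then show ?thesis using L_I[of "k + k'" "j + j'"] kj(3-) by (simp only: hsp_add J_add)
    qed
    show "hscale c a \<in> L" if a: "a \<in> L" for c a
    proof -
      obtain k j where kj: "a = k \<star> x + j" "k \<in> HW" "j \<in> J" using a by (auto simp: L_def)
      have "hscale c a = hscale c k \<star> x + hscale c j" using kj by (simp add: mul_lin hv.scale_right_distrib)
      then show ?thesis using L_I[of "hscale c k" "hscale c j"] kj(2-) by (simp only: hsp_scale J_scale)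
    qed
  qed
  have JL: "J \<subseteq> L" using L_I[OF hsp_0] by fastforce
  have zx: "z \<star> x \<in> L" if "z \<in> V" for z
    using that
  proof (induction rule: V_induct)
    case (TB \<nu> w)
    have "Hb w \<star> Zb \<nu> \<star> x = hscale (\<chi> \<nu>) (Hb w) \<star> x + Hb w \<star> (Zb \<nu> \<star> x - hscale (\<chi> \<nu>) x)"
      by (simp add: mul_lin mul_assoc)
    then show ?case
      using L_I[of "hscale (\<chi> \<nu>) (Hb w)" "Hb w \<star> (Zb \<nu> \<star> x - hscale (\<chi> \<nu>) x)"] TB x(3)
      by (simp add: wt_def J_left hsp_scale ZH_in_hsp)
  qed (use hv.subspace_add[OF L_sub] hv.subspace_scale[OF L_sub] hv.subspace_0[OF L_sub] in \<open>auto simp: mul_lin\<close>)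
  have "y \<star> a \<in> L" if a: "a \<in> L" for y a
  proof -
    obtain k j where kj: "a = k \<star> x + j" "k \<in> HW" "j \<in> J" using a by (auto simp: L_def)
    have "y \<star> a = (y \<star> k) \<star> x + y \<star> j" using kj by (simp add: mul_lin mul_assoc)
    then show ?thesis
      using zx[OF mul_V, of y k] J_left[OF kj(3), of y] JL hv.subspace_add[OF L_sub] by (metis subsetD)
  qed
  moreover have "L \<subseteq> V"
    using J_V by (auto simp: L_def intro!: hsp_add mul_V)
  ultimately have "L = J \<or> L = V"
    using irreducible_left_ideal[OF irr L_sub] JL by blast
  moreover have "x \<in> L" using zx[OF one_V] x(1) by (simp add: one_left HW_V')
  then have "L \<noteq> J" using J_HW x by blast
  ultimately have "Zb 0 \<in> L" using one_V by blast
  then obtain k j where kj: "Zb 0 = k \<star> x + j" "k \<in> HW" "j \<in> J" by (auto simp: L_def)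
  \<comment> \<open>Projecting onto HW removes j and makes the equation exact.\<close>
  have "Zb 0 = pr (k \<star> x + j)" using pr_HW[OF one_HW] kj(1) by simp
  also have "\<dots> = k \<star> x"
    using kj(2,3) x(1) by (simp add: pr_lin pr_HW HW_mul pr_J)
  finally show thesis using that kj(2) by simp
qed

text \<open>The elements that multiply h into J form a left ideal. It contains J because h has
  weight \<tau>, and it omits the unit because h is not in J, so it equals J.\<close>

lemma weight_vector_right_cancel:
  assumes irr: "irreducible_module (hecke_space S) (I_module S m \<tau>) (I_action S m \<tau>)"
    and h: "h \<in> HW" "h \<noteq> 0" "wt \<tau> h" and y: "y \<in> HW" "y \<star> h = 0"
  shows "y = 0"
proof -
  define L where "L = {y \<in> V. y \<star> h \<in> J}"
  have L_sub: "hv.subspace L"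
    by (rule hv.subspaceI) (auto simp: L_def mul_lin hsp_add hsp_scale hsp_0 J_add J_scale J_0)
  have "J \<subseteq> L"
    unfolding J_def
  proof (rule hv.span_minimal[OF _ L_sub], clarify)
    fix x a assume xa: "x \<in> V" "a \<in> A"
    have "(x \<star> a - hscale (char_ext \<tau> a) x) \<star> h = x \<star> (a \<star> h - hscale (char_ext \<tau> a) h)"
      by (simp add: mul_lin mul_assoc)
    also have "\<dots> \<in> J" using wt_A[OF h(3) xa(2)] by (rule J_left)
    finally show "x \<star> a - hscale (char_ext \<tau> a) x \<in> L"
      using xa by (simp add: L_def mul_V hsp_diff hsp_scale)
  qed
  moreover have "z \<star> a \<in> L" if "a \<in> L" for z a
    using that by (simp add: L_def mul_V mul_assoc J_left)
  ultimately have "L = J \<or> L = V"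
    using irreducible_left_ideal[OF irr L_sub] by (auto simp: L_def)
  moreover have "Zb 0 \<notin> L"
    using h J_HW by (auto simp: L_def one_left HW_V')
  ultimately have "L = J" using one_V by blast
  moreover have "y \<in> L" using y by (simp add: L_def HW_V' J_0)
  ultimately show "y = 0" using J_HW y(1) by blast
qed

text \<open>Right multiplication by x is an endomorphism of HW. If x is not a scalar, every x - c is
  a nonzero vector of weight \<tau>, hence cancellable and left invertible, against
  \<open>resolvent_not_everywhere\<close> at the vector \<open>Zb 0\<close>.\<close>

lemma no_other_weight_vector:
  assumes irr: "irreducible_module (hecke_space S) (I_module S m \<tau>) (I_action S m \<tau>)"
    and x: "x \<in> HW" "wt \<tau> x"
  shows "\<exists>c. x = hscale c (Zb 0)"
proof (rule ccontr)
  assume neg: "\<nexists>c. x = hscale c (Zb 0)"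
  let ?h = "\<lambda>c. x - hscale c (Zb 0)"
  have h: "?h c \<in> HW" "?h c \<noteq> 0" "wt \<tau> (?h c)" for c
    using x neg wt_one by (auto intro: hsp_diff hsp_scale one_HW wt_diff_scale)
  have mulh: "y \<star> ?h c = y \<star> x - hscale c y" if "y \<in> HW" for y c
    using that by (simp add: mul_lin one_right HW_V')
  interpret vector_space_endo hscale "\<lambda>y. y \<star> x"
    by unfold_locales (simp_all add: mul_lin)
  show False
  proof (rule resolvent_not_everywhere)
    show "hv.subspace HW" by (rule subspace_hsp)
    show "countable ((\<lambda>(\<nu>, w). ZH \<nu> w) ` ({0 :: 'v} \<times> W))"
      using countable_W by (intro countable_image countable_SIGMA) auto
    show "HW \<subseteq> hv.span ((\<lambda>(\<nu>, w). ZH \<nu> w) ` ({0} \<times> W))"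
      by (simp add: hsp_span)
    show "(\<lambda>y. y \<star> x) ` HW \<subseteq> HW" using HW_mul x(1) by blast
    show "Zb 0 \<in> HW" by (rule one_HW)
    show "Zb 0 \<noteq> (0 :: 'v hecke)" by (metis lookup_ZH lookup_zero zero_neq_one)
    show "y = 0" if "y \<in> HW" "y \<star> x = hscale c y" for c y
      using weight_vector_right_cancel[OF irr h(1,2,3)[of c] that(1)] mulh[OF that(1)] that(2) by simp
    show "\<exists>u\<in>HW. u \<star> x - hscale c u = Zb 0" for c
      using weight_vector_left_invertible[OF irr h(1,2,3)[of c]] mulh by metis
  qed
qed

section \<open>The stabiliser of the character and its reflection subgroup\<close>

lemma W_stab_iff: "w \<in> W_stab S \<tau> \<longleftrightarrow> w \<in> W \<and> (\<forall>\<nu>\<in>Y. \<tau> (w \<nu>) = \<tau> \<nu>)"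
proof -
  have "(\<forall>\<nu>\<in>Y. \<tau> (inv_into UNIV w \<nu>) = \<tau> \<nu>) \<longleftrightarrow> (\<forall>\<nu>\<in>Y. \<tau> (w \<nu>) = \<tau> \<nu>)" if "w \<in> W"
    using that W_Y W_inv_Y W_comp_inv by metis
  then show ?thesis by (auto simp: W_stab_def weyl_act_char_def)
qed

lemma m_inv_GL: "w \<in> W \<Longrightarrow> m_inv GL w = inv_into UNIV w"
  by (rule group.inv_equality[OF GL_group])
    (use W_GL W_inv in \<open>auto simp: GL_def\<close>)

lemma W_stab_comp: "v \<in> W_stab S \<tau> \<Longrightarrow> w \<in> W_stab S \<tau> \<Longrightarrow> v \<circ> w \<in> W_stab S \<tau>"
  by (auto simp: W_stab_iff W_comp W_Y)

text \<open>A generating reflection is conjugate by some w to a simple one, and \<tau> composed with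
  w is 1 at the simple coroot, so \<open>char_rf\<close> applies. These reflections are involutions,
  which settles inverses in the generated group.\<close>

lemma W_refl_sub: "W_refl S \<tau> \<subseteq> W_stab S \<tau>"
proof
  have refl: "r \<in> W_stab S \<tau>" "inv_into UNIV r = r"
    if r: "coroot_reflection S \<beta> r" "\<tau> \<beta> = 1" for \<beta> r
  proof -
    obtain w i where w: "w \<in> W" "i \<in> I" "\<beta> = w (cr i)" "r = w \<circ> rf i \<circ> inv_into UNIV w"
      using r by (auto simp: coroot_reflection_def)
    have rW: "r \<in> W" using w by (auto intro!: W_comp W_rf W_inv)
    have "\<tau> (r \<nu>) = \<tau> \<nu>" if "\<nu> \<in> Y" for \<nu>
    proof -
      have "\<tau> (w (rf i (inv_into UNIV w \<nu>))) = \<tau> (w (inv_into UNIV w \<nu>))"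
        using w that r(2) by (intro char_rf[OF char_comp_W[OF \<tau>]]) (auto intro: W_inv_Y)
      then show ?thesis using w by simp
    qed
    with rW show "r \<in> W_stab S \<tau>" by (simp add: W_stab_iff)
    have "r (r v) = v" for v using w by simp
    then have "r \<circ> r = id" by auto
    then show "inv_into UNIV r = r" by (metis inv_unique_comp)
  qed
  fix w assume "w \<in> W_refl S \<tau>"
  then show "w \<in> W_stab S \<tau>"
    unfolding W_refl_def
  proof (induction rule: generate.induct)
    case one
    have eq: "\<one>\<^bsub>GL\<^esub> = (id :: 'v \<Rightarrow> 'v)" by (simp add: GL_def)
    have "\<one>\<^bsub>GL\<^esub> \<in> W_stab S \<tau>" unfolding eq by (simp add: W_stab_iff W_id)
    then show ?case .
  next
    case (incl h)
    then show ?case using refl by blast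
  next
    case (inv h)
    then have "h \<in> W_stab S \<tau>" "inv_into UNIV h = h" using refl by blast+
    then show ?case by (simp add: m_inv_GL W_stab_iff)
  next
    case (eng h1 h2)
    have eq: "h1 \<otimes>\<^bsub>GL\<^esub> h2 = h1 \<circ> h2" by (simp add: GL_def)
    have "h1 \<otimes>\<^bsub>GL\<^esub> h2 \<in> W_stab S \<tau>" unfolding eq using eng W_stab_comp by blast
    then show ?case .
  qed
qed

text \<open>Besides its weight, the leading term of the constructed vector is tracked; this shows at
  the end that the vector is not a multiple of the unit.\<close>

lemma W_stab_eq_W_refl:
  assumes irr: "irreducible_module (hecke_space S) (I_module S m \<tau>) (I_action S m \<tau>)"
  shows "W_stab S \<tau> = W_refl S \<tau>"
proof (rule ccontr)
  assume "W_stab S \<tau> \<noteq> W_refl S \<tau>"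
  then have "\<exists>u. u \<in> W_stab S \<tau> - W_refl S \<tau>" using W_refl_sub by blast
  then obtain u where u: "u \<in> W_stab S \<tau> - W_refl S \<tau>"
    and min: "\<And>v. v \<in> W_stab S \<tau> - W_refl S \<tau> \<Longrightarrow> len u \<le> len v"
    using ex_has_least_nat[of "\<lambda>u. u \<in> W_stab S \<tau> - W_refl S \<tau>" _ len] by blast
  have uW: "u \<in> W" using u by (simp add: W_stab_iff)
  obtain js where js: "set js \<subseteq> I" "u = word js" "length js = len u"
    using reduced_word[OF uW] by blast
  have comp_refl: "v \<circ> w \<in> W_refl S \<tau>" if "v \<in> W_refl S \<tau>" "w \<in> W_refl S \<tau>" for v w
    using generate.eng[of v GL _ w] that by (simp add: W_refl_def GL_def)
  have take_I: "set (take k js) \<subseteq> I" for k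
    using js(1) set_take_subset by fast
  \<comment> \<open>If the value were 1, the reflection r in this coroot would lie in
    \<open>W_refl\<close>, and \<open>r \<circ> u\<close> would be u with letter k deleted. By
    minimality \<open>r \<circ> u\<close> lies in \<open>W_refl\<close>, hence so does u.\<close>
  have ne1: "\<tau> (word (take k js) (cr (js ! k))) \<noteq> 1" if k: "k < length js" for k
  proof
    let ?a = "word (take k js)" and ?t = "js ! k" and ?b = "word (drop (Suc k) js)"
    assume one: "\<tau> (?a (cr ?t)) = 1"
    have t: "?t \<in> I" using js(1) k nth_mem by blast
    have aW: "?a \<in> W" using take_I by (rule word_W)
    have b_I: "set (drop (Suc k) js) \<subseteq> I" using js(1) set_drop_subset by fast
    define r where "r = ?a \<circ> rf ?t \<circ> inv_into UNIV ?a"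
    have "?a (cr ?t) \<in> real_coroots S" "coroot_reflection S (?a (cr ?t)) r"
      using aW t by (auto simp: real_coroots_def coroot_reflection_def r_def)
    then have r: "r \<in> W_refl S \<tau>"
      unfolding W_refl_def using one by (intro generate.incl) blast
    have "js = take k js @ ?t # drop (Suc k) js" using k by (simp add: id_take_nth_drop)
    then have u_eq: "u = ?a \<circ> (rf ?t \<circ> ?b)"
      using js(2) by (metis word_append word_simps(2))
    have "r (u v) = ?a (?b v)" for v
      using aW t by (simp add: r_def u_eq)
    then have ru: "r \<circ> u = word (take k js @ drop (Suc k) js)"
      by (auto simp: word_append)
    have "len (r \<circ> u) < len u"
      unfolding ru using len_word[of "take k js @ drop (Suc k) js"] take_I[of k] b_I k js(3) by simp
    moreover have "r \<circ> u \<in> W_stab S \<tau>"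
      using r W_refl_sub u W_stab_comp by blast
    ultimately have "r \<circ> u \<in> W_refl S \<tau>" using min[of "r \<circ> u"] by fastforce
    then have "r \<circ> (r \<circ> u) \<in> W_refl S \<tau>" using comp_refl r by blast
    moreover have "r (r v) = v" for v using aW t by (simp add: r_def)
    then have "r \<circ> (r \<circ> u) = u" by (simp add: fun_eq_iff)
    ultimately show False using u by simp
  qed
  \<comment> \<open>Intertwiners multiply from the left, so the leading term collects the letters in
    reverse order, while the weight composes them in the given order.\<close>
  let ?v = "\<lambda>k. word (rev (take k js))"
  have vW: "?v k \<in> W" for k using take_I by (intro word_W) simp
  have len_v: "len (?v k) = k" if "k \<le> length js" for k
    using that take_I reduced_take[of js k] js len_rev_word[of "take k js"] by simp
  have "\<exists>x\<in>HW. wt (\<lambda>\<nu>. \<tau> (word (take k js) \<nu>)) x \<and> x - Hb (?v k) \<in> shorter k" if "k \<le> length js" for k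
    using that
  proof (induction k)
    case 0
    have "wt (\<lambda>\<nu>. \<tau> (word (take 0 js) \<nu>)) (Zb 0)" using wt_one by simp
    moreover have "Zb 0 - Hb (?v 0) \<in> shorter 0" by (simp add: hsp_0)
    ultimately show ?case using one_HW by blast
  next
    case (Suc k)
    then obtain x where x: "x \<in> HW" "wt (\<lambda>\<nu>. \<tau> (word (take k js) \<nu>)) x" "x - Hb (?v k) \<in> shorter k"
      by auto
    let ?t = "js ! k" and ?\<chi> = "\<lambda>\<nu>. \<tau> (word (take k js) \<nu>)"
    have t: "?t \<in> I" using js(1) Suc.prems nth_mem[of k js] by auto
    have tk: "take (Suc k) js = take k js @ [?t]"
      using Suc.prems by (simp add: take_Suc_conv_app_nth)
    let ?E = "Es ?t (Qc (?\<chi> (cr ?t)))"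
    have "wt (\<lambda>\<nu>. ?\<chi> (rf ?t \<nu>)) (?E \<star> x)"
      using Suc.prems by (intro wt_step[OF char_comp_W[OF \<tau> word_W[OF take_I]] x(2) t] ne1) simp
    then have 1: "wt (\<lambda>\<nu>. \<tau> (word (take (Suc k) js) \<nu>)) (?E \<star> x)"
      by (simp add: tk word_append)
    have 2: "?E \<star> x \<in> HW" using t x(1) by (intro HW_mul Es_HW)
    have vk: "?v (Suc k) = rf ?t \<circ> ?v k" by (simp add: tk)
    have up: "Hb (rf ?t) \<star> Hb (?v k) = Hb (?v (Suc k))"
      using Hb_up[OF t vW[of k]] len_v[of k] len_v[of "Suc k"] Suc.prems unfolding vk by simp
    have "Hb (rf ?t) \<star> (x - Hb (?v k)) \<in> shorter (Suc k)"
      using t x(3) by (rule Hb_rf_shorter)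
    moreover have "x \<in> shorter (Suc k)"
    proof -
      have "Hb (?v k) \<in> shorter (Suc k)"
        using vW[of k] len_v[of k] Suc.prems by (intro ZH_in_hsp) (simp add: Y_lattice_closed)
      moreover have "shorter k \<subseteq> shorter (Suc k)" by (intro hsp_mono) auto
      ultimately have "(x - Hb (?v k)) + Hb (?v k) \<in> shorter (Suc k)"
        using x(3) by (intro hsp_add) auto
      then show ?thesis by simp
    qed
    \<comment> \<open>The image of the lower terms and the scalar part of \<open>?E\<close> both
      stay at length at most k, below the new leading term of length k + 1.\<close>
    ultimately have "Hb (rf ?t) \<star> (x - Hb (?v k)) - hscale (Qc (?\<chi> (cr ?t))) x \<in> shorter (Suc k)"
      by (intro hsp_diff hsp_scale)
    then have "?E \<star> x - Hb (?v (Suc k)) \<in> shorter (Suc k)"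
      using up x(1) by (simp add: Es_mul HW_V' mul_lin algebra_simps)
    with 1 2 show ?case by blast
  qed
  from this[of "length js"] obtain x where x: "x \<in> HW" "wt (\<lambda>\<nu>. \<tau> (u \<nu>)) x"
      "x - Hb (word (rev js)) \<in> shorter (length js)"
    using js by auto
  have "wt \<tau> x" by (rule wt_cong[OF x(2)]) (use u in \<open>simp add: W_stab_iff\<close>)
  then obtain c where c: "x = hscale c (Zb 0)" using no_other_weight_vector irr x(1) by blast
  have lenr: "len (word (rev js)) = length js" using len_v[of "length js"] by simp
  \<comment> \<open>A multiple of the unit is supported at the identity alone, so a leading term
    with coefficient 1 can only sit there.\<close>
  have "Poly_Mapping.lookup (x - Hb (word (rev js))) (0, word (rev js)) = 0"
    using x(3) lenr by (intro hsp_lookup) auto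
  then have "word (rev js) = id"
    by (auto simp: c lookup_minus lookup_ZH split: if_splits)
  then have "length js = 0" using lenr by simp
  then have "u = id" using js by simp
  moreover have "id \<in> W_refl S \<tau>"
    using generate.one[of GL] by (simp add: W_refl_def GL_def)
  ultimately show False using u by simp
qed

section \<open>The value q at real coroots\<close>

lemma coroot_value_ne_q:
  assumes irr: "irreducible_module (hecke_space S) (I_module S m \<tau>) (I_action S m \<tau>)"
    and \<beta>: "\<beta> \<in> real_coroots S"
  shows "\<tau> \<beta> \<noteq> of_nat q"
proof
  assume \<beta>q: "\<tau> \<beta> = of_nat q"
  \<comment> \<open>Both zeros of \<open>Qc_discriminant\<close> must be avoided along the word, so
    minimality is taken over the two values together.\<close>
  define bad :: "complex \<Rightarrow> bool" where "bad z \<longleftrightarrow> z = of_nat q \<or> z = 1 / of_nat q" for z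
  have bad_ne: "z \<noteq> 0" "z \<noteq> 1" if "bad z" for z
    using that q_ge_2 by (auto simp: bad_def)
  define bads where "bads p \<longleftrightarrow> set (fst p) \<subseteq> I \<and> snd p \<in> I \<and> bad (\<tau> (word (fst p) (cr (snd p))))"
    for p :: "'i list \<times> 'i"
  obtain w i where "w \<in> W" "i \<in> I" "\<beta> = w (cr i)" using \<beta> by (auto simp: real_coroots_def)
  then obtain ws where "set ws \<subseteq> I" "w = word ws" using W_words by auto
  then have "bads (ws, i)"
    using \<beta>q \<open>i \<in> I\<close> \<open>\<beta> = w (cr i)\<close> by (simp add: bads_def bad_def)
  then obtain p where p: "bads p" and min: "\<And>p'. bads p' \<Longrightarrow> length (fst p) \<le> length (fst p')"
    using ex_has_least_nat[of bads _ "\<lambda>p. length (fst p)"] by blast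
  obtain js i where ji: "p = (js, i)" by (cases p)
  have js: "set js \<subseteq> I" "i \<in> I" "bad (\<tau> (word js (cr i)))" using p ji by (auto simp: bads_def)
  have short: "\<not> bad (\<tau> (word ks (cr k)))" if "length ks < length js" "set ks \<subseteq> I" "k \<in> I" for ks k
    using min[of "(ks, k)"] that ji by (auto simp: bads_def)
  have take_I: "set (take k js) \<subseteq> I" for k
    using js(1) set_take_subset by fast
  have "\<exists>x\<in>HW. \<exists>x'\<in>HW. wt (\<lambda>\<nu>. \<tau> (word (take k js) \<nu>)) x \<and> x' \<star> x = Zb 0 \<and> x \<star> x' = Zb 0"
    if "k \<le> length js" for k
    using that
  proof (induction k)
    case 0
    have "wt (\<lambda>\<nu>. \<tau> (word (take 0 js) \<nu>)) (Zb 0)" using wt_one by simp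
    moreover have "Zb 0 \<star> Zb 0 = Zb 0" by (simp add: one_left one_V)
    ultimately show ?case using one_HW by blast
  next
    case (Suc k)
    obtain x x' where x: "x \<in> HW" "x' \<in> HW" "wt (\<lambda>\<nu>. \<tau> (word (take k js) \<nu>)) x"
        "x' \<star> x = Zb 0" "x \<star> x' = Zb 0"
      using Suc.IH[OF Suc_leD[OF Suc.prems]] by blast
    let ?t = "js ! k" and ?\<chi> = "\<lambda>\<nu>. \<tau> (word (take k js) \<nu>)"
    have k: "k < length js" using Suc.prems by simp
    have t: "?t \<in> I" using js(1) k nth_mem by blast
    have tk: "take (Suc k) js = take k js @ [?t]"
      using k by (simp add: take_Suc_conv_app_nth)
    have b_I: "set (drop (Suc k) js) \<subseteq> I" using js(1) set_drop_subset by fast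
    have \<chi>: "torus_character S ?\<chi>" by (rule char_comp_W[OF \<tau> word_W[OF take_I]])
    let ?z = "?\<chi> (cr ?t)"
    have z0: "?z \<noteq> 0" using \<chi> cr_Y[OF t] by (simp add: torus_character_def)
    have nb: "\<not> bad ?z" using short[of "take k js" ?t] k take_I t by simp
    \<comment> \<open>If the value were 1, the reflection at this letter would not change the
      character, and deleting the letter would give a shorter bad pair.\<close>
    have z1: "?z \<noteq> 1"
    proof
      assume one: "?z = 1"
      let ?\<nu> = "word (drop (Suc k) js) (cr i)"
      have "?\<nu> \<in> Y" using b_I cr_Y[OF js(2)] by (rule word_Y)
      then have "?\<chi> (rf ?t ?\<nu>) = ?\<chi> ?\<nu>" using one by (intro char_rf[OF \<chi> t])
      moreover have "js = take k js @ ?t # drop (Suc k) js" using k by (simp add: id_take_nth_drop)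
      then have "word js = word (take k js) \<circ> (rf ?t \<circ> word (drop (Suc k) js))"
        by (metis word_append word_simps(2))
      ultimately have "\<tau> (word js (cr i)) = \<tau> (word (take k js @ drop (Suc k) js) (cr i))"
        by (simp add: word_append)
      then show False
        using short[of "take k js @ drop (Suc k) js" i] js k take_I[of k] b_I by simp
    qed
    define Q where "Q = Qc ?z"
    define d where "d = 1 + Q * (hc - Q)"
    \<comment> \<open>Minimality excludes q and 1/q at this letter, so the intertwiner has a
      two-sided inverse \<open>E'\<close>.\<close>
    have "d \<noteq> 0"
      using Qc_discriminant[OF z0 z1] nb z1 by (simp add: d_def Q_def bad_def)
    define E' where "E' = hscale (inverse d) (Es ?t (hc - Q))"
    have E'E: "E' \<star> Es ?t Q = Zb 0"
      using Es_Es[OF t, of "hc - Q" Q] \<open>d \<noteq> 0\<close> by (simp add: E'_def mul_lin d_def mult.commute)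
    have EE': "Es ?t Q \<star> E' = Zb 0"
      using Es_Es[OF t, of Q "hc - Q"] \<open>d \<noteq> 0\<close> by (simp add: E'_def mul_lin d_def)
    have "wt (\<lambda>\<nu>. ?\<chi> (rf ?t \<nu>)) (Es ?t Q \<star> x)"
      unfolding Q_def by (rule wt_step[OF \<chi> x(3) t z1])
    then have "wt (\<lambda>\<nu>. \<tau> (word (take (Suc k) js) \<nu>)) (Es ?t Q \<star> x)"
      by (simp add: tk word_append)
    moreover have "(x' \<star> E') \<star> (Es ?t Q \<star> x) = Zb 0"
    proof -
      have "(x' \<star> E') \<star> (Es ?t Q \<star> x) = x' \<star> ((E' \<star> Es ?t Q) \<star> x)" by (simp only: mul_assoc)
      then show ?thesis by (simp add: E'E one_left HW_V' x)
    qed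
    moreover have "(Es ?t Q \<star> x) \<star> (x' \<star> E') = Zb 0"
    proof -
      have "(Es ?t Q \<star> x) \<star> (x' \<star> E') = Es ?t Q \<star> ((x \<star> x') \<star> E')" by (simp only: mul_assoc)
      moreover have "E' \<in> V" unfolding E'_def using t by (intro hsp_scale HW_V' Es_HW)
      ultimately show ?thesis by (simp add: EE' one_left x)
    qed
    moreover have "Es ?t Q \<star> x \<in> HW" "x' \<star> E' \<in> HW"
      using t x by (auto simp: E'_def intro!: HW_mul Es_HW hsp_scale)
    ultimately show ?case by blast
  qed
  from this[of "length js"] obtain x x' where x: "x \<in> HW" "x' \<in> HW" "wt (\<lambda>\<nu>. \<tau> (word js \<nu>)) x"
      "x' \<star> x = Zb 0" "x \<star> x' = Zb 0"
    by auto
  let ?z = "\<tau> (word js (cr i))"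
  define Q where "Q = Qc ?z"
  note z = bad_ne[OF js(3)]
  \<comment> \<open>At the last step the discriminant vanishes, so a nonzero element annihilates the
    intertwiner from the right.\<close>
  have "1 + Q * (hc - Q) = 0"
    using Qc_discriminant[OF z] js(3) by (auto simp: Q_def bad_def)
  then have EE: "Es i Q \<star> Es i (hc - Q) = 0"
    using Es_Es[OF js(2), of Q "hc - Q"] by simp
  have wtE: "wt (\<lambda>\<nu>. \<tau> (word js (rf i \<nu>))) (Es i Q \<star> x)"
    unfolding Q_def by (rule wt_step[OF char_comp_W[OF \<tau> word_W[OF js(1)]] x(3) js(2) z(2)])
  have EV: "Es i a \<in> V" for a using js(2) by (intro HW_V' Es_HW)
  have Exx: "Es i Q \<star> x \<star> x' = Es i Q" by (simp add: mul_assoc x one_right EV)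
  have "Es i Q \<star> x \<noteq> 0"
    using Exx Es_nonzero[OF js(2)] by auto
  moreover have "Es i Q \<star> x \<in> HW" using js x by (intro HW_mul Es_HW)
  ultimately obtain k where k: "k \<in> HW" "k \<star> (Es i Q \<star> x) = Zb 0"
    using weight_vector_left_invertible[OF irr _ _ wtE] by blast
  \<comment> \<open>A left inverse k forces \<open>k \<star> Es i Q\<close> to equal
    \<open>x'\<close>. Multiplying by \<open>Es i (hc - Q)\<close> on the right gives 0, and
    cancelling the unit \<open>x'\<close> leaves \<open>Es i (hc - Q) = 0\<close>, which is
    false.\<close>
  have "k \<star> Es i Q = k \<star> (Es i Q \<star> x) \<star> x'"
    by (simp add: mul_assoc[of k] Exx)
  then have "k \<star> Es i Q = x'" using k x by (simp add: one_left HW_V')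
  then have "x' \<star> Es i (hc - Q) = 0"
    using EE by (metis mul_assoc mul_zero(2))
  then have "x \<star> x' \<star> Es i (hc - Q) = 0" by (simp add: mul_assoc)
  then show False using x Es_nonzero[OF js(2)] by (simp add: one_left EV)
qed

end

text \<open>The classes of 0 and 1 differ. The bound keeps q and 1/q away from 0 and 1, so the
  intertwiner is defined at a coroot with such a value.\<close>

lemma residue_field_card_ge_2:
  assumes v: "nonarch_local_field (v :: 'k::field \<Rightarrow> int)"
  shows "2 \<le> card (residue_field v)"
proof -
  let ?R = "{(x, y). x \<in> val_ideal v 0 \<and> y \<in> val_ideal v 0 \<and> x - y \<in> val_ideal v 1}"
  have mult: "\<And>x y. x \<noteq> 0 \<Longrightarrow> y \<noteq> 0 \<Longrightarrow> v (x * y) = v x + v y"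
    and fin: "finite (residue_field v)"
    using v by (auto simp: nonarch_local_field_def)
  have v1: "v 1 = 0" using mult[of 1 1] by simp
  have 0: "0 \<in> val_ideal v 0" and 1: "1 \<in> val_ideal v 0"
    by (auto simp: val_ideal_def v1)
  have "1 \<in> ?R `` {1}" using 1 by (auto simp: val_ideal_def v1)
  moreover have "1 \<notin> ?R `` {0}"
  proof -
    \<comment> \<open>The square of -1 is 1, so -1 has valuation 0 and 0 - 1 is not in the maximal
      ideal.\<close>
    have "v (-1) + v (-1) = 0" using mult[of "-1" "-1"] v1 by simp
    then show ?thesis by (simp add: val_ideal_def)
  qed
  ultimately have ne: "?R `` {0} \<noteq> ?R `` {1}" by blast
  have "{?R `` {0}, ?R `` {1}} \<subseteq> residue_field v"
    unfolding residue_field_def using quotientI[OF 0, of ?R] quotientI[OF 1, of ?R] by blast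
  then have "card {?R `` {0}, ?R `` {1}} \<le> card (residue_field v)"
    using fin by (rule card_mono[rotated])
  then show ?thesis using ne by simp
qed

theorem theorem3:
  fixes S :: "('i, 'v::real_vector) root_system"
    and val :: "'k::field \<Rightarrow> int"
    and q :: nat
    and m :: "'v hecke \<Rightarrow> 'v hecke \<Rightarrow> 'v hecke"
    and \<tau> :: "'v \<Rightarrow> complex"
  assumes "root_generating_system S"
    and "nonarch_local_field val" and "q = card (residue_field val)"
    and "BLH_product S q m"
    and "torus_character S \<tau>"
    and "irreducible_module (hecke_space S) (I_module S m \<tau>) (I_action S m \<tau>)"
  shows "W_stab S \<tau> = W_refl S \<tau> \<and> (\<forall>\<beta>\<in>real_coroots S. \<tau> \<beta> \<noteq> of_nat q)"
proof -
  have "2 \<le> q" using residue_field_card_ge_2[OF assms(2)] assms(3) by simp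
  then interpret principal_series S q m \<tau>
    by unfold_locales (use assms in auto)
  show ?thesis
    using W_stab_eq_W_refl[OF assms(6)] coroot_value_ne_q[OF assms(6)] by blast
qed

end
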